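(* Let $\mathcal X,\mathcal Y$ be Hilbert spaces. Suppose that $(\mathbf Z,X)$ is an admissible homogeneous interpolation data set and let $\mathcal M_{\mathbf Z,X}=\operatorname{Ker}\mathcal C_{\mathbf Z,X}$ be the associated shift-invariant subspace of $H^2_{\mathcal Y}(\mathcal F_d)$. Let $(C,\mathbf A)$ be the output pair defined by $(C,\mathbf A)=(X^*,\mathbf Z^* )$, i.e. $C=X^*$, $A_j=Z_j^*$, and let $A:\mathcal X\to\mathcal X^d$ be the column of $A_1,\dots,A_d$. Choose an input (Hilbert) space $\mathcal U$ with $$\dim\mathcal U=\operatorname{rank}\left(I_{\mathcal X^d\oplus\mathcal Y}-\begin{bmatrix} A \\ C \end{bmatrix}\begin{bmatrix}A^*&C^*\end{bmatrix}\right)$$ and define an operator $\begin{bmatrix} B \\ D \end{bmatrix}:\mathcal U\to\mathcal X^d\oplus\mathcal Y$ as a solution of the Cholesky factorization problem $$\begin{bmatrix} B \\ D \end{bmatrix}\begin{bmatrix}B^*&D^*\end{bmatrix}=I_{\mathcal X^d\oplus\mathcal Y}-\begin{bmatrix} A \\ C \end{bmatrix}\begin{bmatrix}A^*&C^*\end{bmatrix}.$$ Set $\mathbf U=\begin{bmatrix} A & B \\ C & D \end{bmatrix}$ and let $\theta\in\mathcal S_{nc,d}(\mathcal U,\mathcal Y)$ be the transfer function of $\mathbf U$: $$\theta(z)=D+C(I-Z(z)A)^{-1}Z(z)B.$$ Then $\theta$ is inner and $\mathcal M_{\mathbf Z,X}=\theta\cdot H^2_{\mathcal U}(\mathcal 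F_d)$.
   Context: $d\ge1$ is a fixed integer and $\mathcal F_d$ is the free semigroup with unit generated by the letters $\{1,\dots,d\}$: words $v=i_N\cdots i_1$ of length $|v|=N$, product given by concatenation, unit the empty word $\emptyset$; $v^\top=i_1\cdots i_N$. $z=(z_1,\dots,z_d)$ are noncommuting indeterminates commuting with operator coefficients; $z^v=z_{i_N}\cdots z_{i_1}$, $z^\emptyset=1$; for an operator tuple $\mathbf A=(A_1,\dots,A_d)$, $\mathbf A^v=A_{i_N}\cdots A_{i_1}$, $\mathbf A^\emptyset=I$. Products of formal power series are given by convolution. $H^2_{\mathcal Y}(\mathcal F_d)=\{f=\sum_vf_vz^v:\ f_v\in\mathcal Y,\ \|f\|^2=\sum_v\|f_v\|^2<\infty\}$. The (right) shifts are $S_j:f(z)\mapsto f(z)z_j$, $j=1,\dots,d$; a subspace is shift-invariant if it is invariant under every $S_j$. $\mathcal S_{nc,d}(\mathcal U,\mathcal Y)$ is the set of formal power series $S(z)$ with coefficients in the space $\mathcal L(\mathcal U,\mathcal Y)$ of bounded operators from $\mathcal U$ to $\mathcal Y$ for which $M_S:f(z)\mapsto S(z)f(z)$ is a contraction from $H^2_{\mathcal U}(\mathcal F_d)$ into $H^2_{\mathcal Y}(\mathcal F_d)$; such $S$ is inner if $M_S$ is isometric. An input pair $(\mathbf Z,X)$ consists of $\mathbf Z=(Z_1,\dots,Z_d)$ with bounded $Z_j:\mathcal X\to\mathcal X$ and bounded $X:\mathcal Y\to\mathcal X$. It is isometric if $I_{\mathcal X}-Z_1Z_1^*-\cdots-Z_dZ_d^*=XX^*$.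 A tuple $\mathbf A$ on $\mathcal X$ is strongly stable if $\lim_{N\to\infty}\sum_{|v|=N}\|\mathbf A^vx\|^2=0$ for all $x\in\mathcal X$. An admissible homogeneous interpolation data set is an isometric input pair $(\mathbf Z,X)$ such that $\mathbf Z^*=(Z_1^*,\dots,Z_d^* )$ is strongly stable. For such a pair, the controllability operator is $$\mathcal C_{\mathbf Z,X}:H^2_{\mathcal Y}(\mathcal F_d)\to\mathcal X,\qquad\mathcal C_{\mathbf Z,X}f=\sum_{v\in\mathcal F_d}\mathbf Z^{v^\top}Xf_v,$$ and $\mathcal M_{\mathbf Z,X}=\{f\in H^2_{\mathcal Y}(\mathcal F_d):\mathcal C_{\mathbf Z,X}f=0\}$. $Z(z)=\begin{bmatrix}z_1I_{\mathcal X}&\cdots&z_dI_{\mathcal X}\end{bmatrix}$ and $C(I-Z(z)A)^{-1}Z(z)B=\sum_{j=1}^d\sum_{v\in\mathcal F_d}C\mathbf A^vB_jz^vz_j$, with $B$ the column of $B_1,\dots,B_d$, $B_j:\mathcal U\to\mathcal X$.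
   Formalization: When the input space U is infinite-dimensional, the solution [B;D] of the Cholesky factorization problem is additionally required to be injective; otherwise the claim fails, e.g. for X={0}, Y=U=l^2 and D the backward shift, where theta is not inner. *)

theory Defs
  imports "HOL-Analysis.Analysis"
begin

section \<open>Complex Hilbert spaces\<close>

text \<open>
  The inner product is conjugate-linear in its first argument. Norm, metric and topology are those
  of the underlying real inner product space, whose inner product is the real part.
\<close>

class complex_inner = real_inner +
  fixes scaleC :: "complex \<Rightarrow> 'a \<Rightarrow> 'a" (infixr "*\<^sub>C" 75)
    and cinner :: "'a \<Rightarrow> 'a \<Rightarrow> complex"
  assumes scaleC_add_right: "c *\<^sub>C (x + y) = c *\<^sub>C x + c *\<^sub>C y"
    and scaleC_add_left: "(b + c) *\<^sub>C x = b *\<^sub>C x + c *\<^sub>C x"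
    and scaleC_scaleC: "b *\<^sub>C c *\<^sub>C x = (b * c) *\<^sub>C x"
    and scaleC_of_real: "complex_of_real r *\<^sub>C x = r *\<^sub>R x"
    and cinner_commute: "cinner x y = cnj (cinner y x)"
    and cinner_add_left: "cinner (x + y) z = cinner x z + cinner y z"
    and cinner_scaleC_left: "cinner (c *\<^sub>C x) y = cnj c * cinner x y"
    and Re_cinner: "Re (cinner x y) = inner x y"

class complex_hilbert_space = complex_inner + complete_space

instantiation prod :: (complex_inner, complex_inner) complex_inner
begin

definition scaleC_prod_def: "c *\<^sub>C p = (c *\<^sub>C fst p, c *\<^sub>C snd p)"

definition cinner_prod_def: "cinner p q = cinner (fst p) (fst q) + cinner (snd p) (snd q)"

instance
proof
  fix b c :: complex and r :: real and x y z :: "'a \<times> 'b"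
  show "c *\<^sub>C (x + y) = c *\<^sub>C x + c *\<^sub>C y"
    by (simp add: scaleC_prod_def scaleC_add_right)
  show "(b + c) *\<^sub>C x = b *\<^sub>C x + c *\<^sub>C x"
    by (simp add: scaleC_prod_def scaleC_add_left)
  show "b *\<^sub>C c *\<^sub>C x = (b * c) *\<^sub>C x"
    by (simp add: scaleC_prod_def scaleC_scaleC)
  show "complex_of_real r *\<^sub>C x = r *\<^sub>R x"
    by (simp add: scaleC_prod_def scaleC_of_real prod_eq_iff)
  show "cinner x y = cnj (cinner y x)"
    unfolding cinner_prod_def complex_cnj_add
    by (intro arg_cong2[where f = "(+)"] cinner_commute)
  show "cinner (x + y) z = cinner x z + cinner y z"
    by (simp add: cinner_prod_def cinner_add_left)
  show "cinner (c *\<^sub>C x) y = cnj c * cinner x y"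
    by (simp add: cinner_prod_def scaleC_prod_def cinner_scaleC_left distrib_left)
  show "Re (cinner x y) = inner x y"
    by (simp add: cinner_prod_def Re_cinner inner_prod_def)
qed

end

instance prod :: (complex_hilbert_space, complex_hilbert_space) complex_hilbert_space ..

instantiation vec :: (complex_inner, finite) complex_inner
begin

definition scaleC_vec_def: "c *\<^sub>C x = (\<chi> j. c *\<^sub>C (x $ j))"

definition cinner_vec_def: "cinner x y = (\<Sum>j\<in>UNIV. cinner (x $ j) (y $ j))"

instance
proof
  fix b c :: complex and r :: real and x y z :: "('a, 'b) vec"
  show "c *\<^sub>C (x + y) = c *\<^sub>C x + c *\<^sub>C y"
    by (simp add: scaleC_vec_def scaleC_add_right vec_eq_iff)
  show "(b + c) *\<^sub>C x = b *\<^sub>C x + c *\<^sub>C x"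
    by (simp add: scaleC_vec_def scaleC_add_left vec_eq_iff)
  show "b *\<^sub>C c *\<^sub>C x = (b * c) *\<^sub>C x"
    by (simp add: scaleC_vec_def scaleC_scaleC vec_eq_iff)
  show "complex_of_real r *\<^sub>C x = r *\<^sub>R x"
    by (simp add: scaleC_vec_def scaleC_of_real vec_eq_iff)
  show "cinner x y = cnj (cinner y x)"
    unfolding cinner_vec_def cnj_sum by (intro sum.cong refl cinner_commute)
  show "cinner (x + y) z = cinner x z + cinner y z"
    by (simp add: cinner_vec_def cinner_add_left sum.distrib)
  show "cinner (c *\<^sub>C x) y = cnj c * cinner x y"
    by (simp add: cinner_vec_def scaleC_vec_def cinner_scaleC_left sum_distrib_left)
  show "Re (cinner x y) = inner x y"
    by (simp add: cinner_vec_def Re_cinner inner_vec_def)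
qed

end

instance vec :: (complex_hilbert_space, finite) complex_hilbert_space ..

global_interpretation complex_vector: vector_space "scaleC :: complex \<Rightarrow> 'a \<Rightarrow> 'a::complex_inner"
proof
  fix b c :: complex and x y :: 'a
  show "c *\<^sub>C (x + y) = c *\<^sub>C x + c *\<^sub>C y" by (rule scaleC_add_right)
  show "(b + c) *\<^sub>C x = b *\<^sub>C x + c *\<^sub>C x" by (rule scaleC_add_left)
  show "b *\<^sub>C c *\<^sub>C x = (b * c) *\<^sub>C x" by (rule scaleC_scaleC)
  show "1 *\<^sub>C x = x" using scaleC_of_real[of 1 x] by simp
qed


section \<open>Operators, Hilbert dimension, rank\<close>

definition bounded_clinear :: "('a::complex_inner \<Rightarrow> 'b::complex_inner) \<Rightarrow> bool" where
  "bounded_clinear T \<longleftrightarrow> bounded_linear T \<and> (\<forall>c x. T (c *\<^sub>C x) = c *\<^sub>C T x)"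

text \<open>For a bounded operator between Hilbert spaces the described map exists (Riesz).\<close>

definition cadjoint :: "('a::complex_inner \<Rightarrow> 'b::complex_inner) \<Rightarrow> 'b \<Rightarrow> 'a" where
  "cadjoint T = (THE S. \<forall>x y. cinner (T x) y = cinner x (S y))"

definition orthonormal_basis :: "'a::complex_inner set \<Rightarrow> 'a set \<Rightarrow> bool" where
  "orthonormal_basis E S \<longleftrightarrow>
     (\<forall>e\<in>E. cinner e e = 1) \<and> pairwise (\<lambda>e e'. cinner e e' = 0) E \<and>
     closure (complex_vector.span E) = S"

text \<open>
  The Hilbert dimension of a closed subspace is a cardinal, in the sense of the library's
  cardinals-as-wellorders; these are to be compared up to order isomorphism \<^const>\<open>ordIso\<close>.
  All orthonormal bases of a closed subspace are equipotent, so the choice does not matter.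
\<close>

definition hilbert_dim :: "'a::complex_inner set \<Rightarrow> 'a rel" where
  "hilbert_dim S = card_of (SOME E. orthonormal_basis E S)"

definition op_rank :: "('a::complex_inner \<Rightarrow> 'b::complex_inner) \<Rightarrow> 'b rel" where
  "op_rank T = hilbert_dim (closure (range T))"

text \<open>
  Pitfall: if \<open>T T\<^sup>* = P\<close> is a projection and \<open>dim U = rank P\<close> is finite, then \<open>T\<close> is
  injective on \<open>U\<close>. If the common dimension is infinite this can fail (a backward shift
  satisfies \<open>T T\<^sup>* = I\<close>), so in that case injectivity has to be demanded separately.
\<close>

definition finite_dimensional :: "'a::complex_inner set \<Rightarrow> bool" where
  "finite_dimensional S \<longleftrightarrow> (\<exists>E. finite E \<and> complex_vector.span E = S)"

definition col_op :: "('a \<Rightarrow> 'b) \<Rightarrow> ('a \<Rightarrow> 'c) \<Rightarrow> 'a \<Rightarrow> 'b \<times> 'c" where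
  "col_op S T = (\<lambda>x. (S x, T x))"

definition row_op :: "('b \<Rightarrow> 'a::plus) \<Rightarrow> ('c \<Rightarrow> 'a) \<Rightarrow> 'b \<times> 'c \<Rightarrow> 'a" where
  "row_op S T = (\<lambda>(p, q). S p + T q)"


section \<open>Words and formal power series\<close>

text \<open>
  The letters are the elements of a finite type \<open>'d\<close>. The word \<open>i\<^sub>N \<dots> i\<^sub>1\<close> is
  the list \<open>[i\<^sub>N, \<dots>, i\<^sub>1]\<close>; concatenation is \<open>@\<close>, the unit is \<open>[]\<close> and
  transposition is \<^const>\<open>rev\<close>. A formal power series is its family of coefficients.
\<close>

fun word_op :: "('d \<Rightarrow> 'x \<Rightarrow> 'x) \<Rightarrow> 'd list \<Rightarrow> 'x \<Rightarrow> 'x" where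
  "word_op A [] = id"
| "word_op A (i # v) = A i \<circ> word_op A v"

definition H2 :: "('d::finite list \<Rightarrow> 'y::complex_inner) set" where
  "H2 = {f. (\<lambda>v. (norm (f v))\<^sup>2) summable_on UNIV}"

definition H2_norm :: "('d::finite list \<Rightarrow> 'y::complex_inner) \<Rightarrow> real" where
  "H2_norm f = sqrt (\<Sum>\<^sub>\<infinity>v. (norm (f v))\<^sup>2)"

definition series_mult ::
    "('d::finite list \<Rightarrow> 'u \<Rightarrow> 'y) \<Rightarrow> ('d list \<Rightarrow> 'u) \<Rightarrow> 'd list \<Rightarrow> 'y::comm_monoid_add" where
  "series_mult S f = (\<lambda>w. \<Sum>(u, v)\<in>{(u, v). u @ v = w}. S u (f v))"

definition schur_class :: "('d::finite list \<Rightarrow> 'u::complex_inner \<Rightarrow> 'y::complex_inner) set" where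
  "schur_class = {S. (\<forall>v. bounded_clinear (S v)) \<and>
     (\<forall>f\<in>H2. series_mult S f \<in> H2 \<and> H2_norm (series_mult S f) \<le> H2_norm f)}"

definition inner_multiplier ::
    "('d::finite list \<Rightarrow> 'u::complex_inner \<Rightarrow> 'y::complex_inner) \<Rightarrow> bool" where
  "inner_multiplier S \<longleftrightarrow>
     S \<in> schur_class \<and> (\<forall>f\<in>H2. H2_norm (series_mult S f) = H2_norm f)"


section \<open>Interpolation data and realizations\<close>

definition isometric_input_pair ::
    "('d::finite \<Rightarrow> 'x::complex_inner \<Rightarrow> 'x) \<Rightarrow> ('y::complex_inner \<Rightarrow> 'x) \<Rightarrow> bool" where
  "isometric_input_pair Z X \<longleftrightarrow>
     (\<forall>j. bounded_clinear (Z j)) \<and> bounded_clinear X \<and>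
     (\<forall>x. x - (\<Sum>j\<in>UNIV. Z j (cadjoint (Z j) x)) = X (cadjoint X x))"

definition strongly_stable :: "('d::finite \<Rightarrow> 'x::complex_inner \<Rightarrow> 'x) \<Rightarrow> bool" where
  "strongly_stable A \<longleftrightarrow>
     (\<forall>x. (\<lambda>N. \<Sum>v\<in>{v. length v = N}. (norm (word_op A v x))\<^sup>2) \<longlonglongrightarrow> 0)"

definition admissible_data ::
    "('d::finite \<Rightarrow> 'x::complex_inner \<Rightarrow> 'x) \<Rightarrow> ('y::complex_inner \<Rightarrow> 'x) \<Rightarrow> bool" where
  "admissible_data Z X \<longleftrightarrow>
     isometric_input_pair Z X \<and> strongly_stable (\<lambda>j. cadjoint (Z j))"

text \<open>For an isometric pair and \<open>f \<in> H2\<close> the sum converges unconditionally.\<close>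

definition controllability_op ::
    "('d::finite \<Rightarrow> 'x::complex_inner \<Rightarrow> 'x) \<Rightarrow> ('y::complex_inner \<Rightarrow> 'x) \<Rightarrow> ('d list \<Rightarrow> 'y) \<Rightarrow> 'x" where
  "controllability_op Z X f = (\<Sum>\<^sub>\<infinity>v. word_op Z (rev v) (X (f v)))"

definition interpolation_subspace ::
    "('d::finite \<Rightarrow> 'x::complex_inner \<Rightarrow> 'x) \<Rightarrow> ('y::complex_inner \<Rightarrow> 'x) \<Rightarrow> ('d list \<Rightarrow> 'y) set" where
  "interpolation_subspace Z X = {f \<in> H2. controllability_op Z X f = 0}"

text \<open>
  Here \<open>A\<close> and \<open>B\<close> are columns with entries \<open>A\<^sub>j\<close>, \<open>B\<^sub>j\<close>. The coefficient of
  \<open>C (I - Z(z) A)\<^sup>-\<^sup>1 Z(z) B\<close> at the empty word is zero, and at the nonempty word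
  \<open>v @ [j]\<close> it is \<open>C A\<^sup>v B\<^sub>j\<close>.
\<close>

definition transfer_function ::
    "('x \<Rightarrow> 'x ^ 'd) \<Rightarrow> ('u \<Rightarrow> 'x ^ 'd) \<Rightarrow> ('x \<Rightarrow> 'y) \<Rightarrow> ('u \<Rightarrow> 'y) \<Rightarrow> 'd::finite list \<Rightarrow> 'u \<Rightarrow> 'y" where
  "transfer_function A B C D w =
     (if w = [] then D
      else (\<lambda>u. C (word_op (\<lambda>j x. A x $ j) (butlast w) (B u $ last w))))"

end

theory Submission
  imports Defs
begin

text \<open>
  Let \<open>V\<close> be the column of \<open>A\<close> and \<open>C\<close> and \<open>T\<close> the column of \<open>B\<close> and \<open>D\<close>. An isometric input pair is
  one for which \<open>V\<close> is an isometry, so \<open>I - V V\<^sup>*\<close> is the projection onto the complement of the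
  range of \<open>V\<close>. The factorisation \<open>T T\<^sup>* = I - V V\<^sup>*\<close> alone makes \<open>T\<close> a partial isometry; together with
  injectivity, which for a finite-dimensional input space follows from the dimension count
  (\<open>inj_if_dim_eq_rank\<close>), it makes \<open>T\<close> an isometry onto this complement (\<open>isometry_completion\<close>).
  Hence the colligation matrix \<open>U = [V T]\<close> is unitary.

  The rest is an argument about the linear system with matrix \<open>U\<close>, run along words:
  \<open>x(jv) = A\<^sub>j x(v) + B\<^sub>j f(v)\<close> and \<open>y(v) = C x(v) + D f(v)\<close>. With initial state \<open>0\<close> its output is
  \<open>\<theta> f\<close> (\<open>transfer_function_output\<close>).

  Since \<open>U\<close> is isometric, the energy that enters with the input leaves with the output or is stored
  in the states (\<open>trajectory_energy\<close>). Strong stability empties the store as the length of the words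
  grows (\<open>level_energy_state\<close>), so multiplication by \<open>\<theta>\<close> is isometric.

  Applying \<open>U\<^sup>*\<close> recovers a state from its successors and the output,
  \<open>x(v) = \<Sum>\<^sub>j Z\<^sub>j x(jv) + X y(v)\<close>. Iterated from the empty word this says that the controllability
  sum of the output, cut off at length \<open>N\<close>, differs from the initial state by a vector whose square
  norm is at most the energy stored at length \<open>N\<close>. So it vanishes on \<open>\<theta> f\<close> in the limit
  (\<open>range_subset_kernel\<close>).

  Conversely, let \<open>g\<close> be annihilated by the controllability operator. The states
  \<open>x(v)\<close>, the values of that operator at the shifted series \<open>w \<mapsto> g(wv)\<close>, satisfy the recovery formula
  with \<open>g\<close> in place of \<open>y\<close>. As \<open>U\<close> is onto, there are inputs \<open>f(v)\<close> that make this a trajectory with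
  output \<open>g\<close>. Its initial state is \<open>0\<close>, so \<open>g = \<theta> f\<close>, and the energy balance
  gives \<open>f \<in> H2\<close> (\<open>kernel_subset_range\<close>).
\<close>

section \<open>Adjoints on complex Hilbert spaces\<close>

lemma cinner_add_right: "cinner x (y + z) = cinner x y + cinner x z"
  using cinner_add_left[of y z x]
  by (simp add: cinner_commute[of x] del: cinner_add_left flip: complex_cnj_add)

lemma cinner_scaleC_right: "cinner x (c *\<^sub>C y) = c * cinner x y"
  by (simp add: cinner_commute[of x "c *\<^sub>C y"] cinner_scaleC_left cinner_commute[of y x])

lemma Im_cinner: "Im (cinner x y) = inner (\<i> *\<^sub>C x) y"
proof -
  have "Re (cinner (\<i> *\<^sub>C x) y) = Im (cinner x y)"
    by (simp add: cinner_scaleC_left)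
  thus ?thesis
    by (simp add: Re_cinner)
qed

lemma cinner_conv_inner: "cinner x y = Complex (inner x y) (inner (\<i> *\<^sub>C x) y)"
  by (simp add: complex_eq_iff Re_cinner Im_cinner)

lemma cinner_self: "cinner x x = complex_of_real ((norm x)\<^sup>2)"
proof -
  have "Im (cinner x x) = 0"
    using cinner_commute[of x x] by (metis Reals_cnj_iff complex_is_Real_iff)
  thus ?thesis
    by (simp add: complex_eq_iff Re_cinner power2_norm_eq_inner)
qed

lemma cinner_zero_right [simp]: "cinner x 0 = 0"
  using cinner_add_right[of x 0 0] by simp

lemma cinner_zero_left [simp]: "cinner 0 x = 0"
  using cinner_add_left[of 0 0 x] by simp

lemma cinner_diff_right: "cinner x (y - z) = cinner x y - cinner x z"
  by (metis add_diff_cancel_right' cinner_add_right diff_add_cancel)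

lemma cinner_sum_right: "cinner x (\<Sum>i\<in>I. f i) = (\<Sum>i\<in>I. cinner x (f i))"
  by (induction I rule: infinite_finite_induct) (simp_all add: cinner_add_right)

lemma cinner_ext:
  assumes "\<And>x. cinner x y = cinner x z"
  shows "y = z"
proof -
  have "cinner (y - z) (y - z) = 0"
    using assms by (simp add: cinner_diff_right)
  thus ?thesis
    by (simp add: cinner_self)
qed

lemma bounded_clinearD:
  assumes "bounded_clinear T"
  shows "bounded_linear T" "T (c *\<^sub>C x) = c *\<^sub>C T x"
  using assms by (auto simp: bounded_clinear_def)

lemma bounded_clinear_comp:
  assumes "bounded_clinear S" "bounded_clinear T"
  shows "bounded_clinear (\<lambda>x. S (T x))"
  using assms by (auto simp: bounded_clinear_def bounded_linear_compose)

text \<open>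
  The representing vector minimises \<open>x \<mapsto> \<parallel>x\<parallel>\<^sup>2 / 2 - \<phi> x\<close>: by the parallelogram law every
  minimising sequence is Cauchy, and at the minimum the directional derivatives
  \<open>\<langle>x, y\<rangle> - \<phi> y\<close> vanish.
\<close>
lemma riesz_representation:
  fixes \<phi> :: "'a::{real_inner,complete_space} \<Rightarrow> real"
  assumes "bounded_linear \<phi>"
  obtains x where "\<And>y. \<phi> y = inner x y"
proof -
  interpret bounded_linear \<phi> by fact
  define J where "J x = inner x x / 2 - \<phi> x" for x
  obtain K where K: "norm (\<phi> x) \<le> norm x * K" for x
    using bounded by blast
  have J_lower: "- K\<^sup>2 / 2 \<le> J x" for x
  proof -
    have "0 \<le> (norm x - K)\<^sup>2" by simp
    hence "norm x * K \<le> (norm x)\<^sup>2 / 2 + K\<^sup>2 / 2"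
      by (simp add: power2_diff mult.commute)
    with K[of x] show ?thesis
      by (simp add: J_def power2_norm_eq_inner)
  qed
  define m where "m = Inf (range J)"
  have bdd: "bdd_below (range J)"
    using J_lower by (intro bdd_belowI[of _ "- K\<^sup>2 / 2"]) auto
  have m_le: "m \<le> J x" for x
    unfolding m_def using bdd by (intro cInf_lower) auto
  have "\<exists>x. J x < m + 1 / real (Suc n)" for n
  proof -
    have "Inf (range J) < m + 1 / real (Suc n)" unfolding m_def by simp
    thus ?thesis using bdd by (subst (asm) cInf_less_iff) auto
  qed
  then obtain s where s: "\<And>n. J (s n) < m + 1 / real (Suc n)" by metis
  have parallelogram: "(norm (x - y))\<^sup>2 = 4 * J x + 4 * J y - 8 * J ((1/2) *\<^sub>R (x + y))" for x y
    unfolding power2_norm_eq_inner J_def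
    by (simp add: inner_diff inner_add scale add inner_commute algebra_simps)
  have "Cauchy s"
  proof (rule CauchyI)
    \<comment> \<open>As \<open>m\<close> bounds \<open>J\<close> from below at midpoints, the squared distance is below \<open>4 / (k + 1) + 4 / (n + 1) \<le> 8 / M\<close>.\<close>
    fix e :: real assume "0 < e"
    then obtain M where M: "8 / e\<^sup>2 < real M"
      using reals_Archimedean2 by blast
    show "\<exists>M. \<forall>m\<ge>M. \<forall>n\<ge>M. norm (s m - s n) < e"
    proof (intro exI allI impI)
      fix k n assume kn: "M \<le> k" "M \<le> n"
      have pos: "real M > 0"
        using M \<open>0 < e\<close> by (meson divide_pos_pos order_less_trans zero_less_numeral zero_less_power)
      have small: "1 / real (Suc i) \<le> 1 / real M" if "M \<le> i" for i
        using that pos by (simp add: frac_le)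
      have "(norm (s k - s n))\<^sup>2 < 8 * (1 / real M)"
        unfolding parallelogram
        using s[of k] s[of n] m_le[of "(1/2) *\<^sub>R (s k + s n)"] small[OF kn(1)] small[OF kn(2)]
        by linarith
      also have "\<dots> < e\<^sup>2"
        using M pos \<open>0 < e\<close> by (simp add: field_simps)
      finally show "norm (s k - s n) < e"
        using \<open>0 < e\<close> by (simp add: power_less_imp_less_base)
    qed
  qed
  then obtain x where x: "s \<longlonglongrightarrow> x"
    using Cauchy_convergent convergent_def by blast
  have "(\<lambda>n. J (s n)) \<longlonglongrightarrow> J x"
    unfolding J_def by (intro tendsto_intros tendsto x) simp
  moreover have "(\<lambda>n. m + 1 / real (Suc n)) \<longlonglongrightarrow> m + 0"
    by (intro tendsto_intros LIMSEQ_inverse_real_of_nat[unfolded inverse_eq_divide])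
  ultimately have "J x \<le> m"
    using s by (intro LIMSEQ_le[of "\<lambda>n. J (s n)" "J x" "\<lambda>n. m + 1 / real (Suc n)"])
      (auto intro!: less_imp_le)
  hence J_min: "J x \<le> J y" for y
    using m_le[of y] by simp
  have "\<phi> y = inner x y" for y
  proof (cases "y = 0")
    case False
    \<comment> \<open>The minimiser of \<open>J\<close> on the line through \<open>x\<close> in direction \<open>y\<close>.\<close>
    define t where "t = (\<phi> y - inner x y) / inner y y"
    have yy: "inner y y > 0" using False by simp
    have "J (x + t *\<^sub>R y) = J x - t * (\<phi> y - inner x y) + t\<^sup>2 * inner y y / 2"
      by (simp add: J_def add scale inner_add inner_commute power2_eq_square algebra_simps)
    also have "t\<^sup>2 * inner y y = t * (\<phi> y - inner x y)"
      using yy by (simp add: t_def power2_eq_square)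
    finally have "t * (\<phi> y - inner x y) \<le> 0"
      using J_min[of "x + t *\<^sub>R y"] by simp
    hence "(\<phi> y - inner x y)\<^sup>2 \<le> 0"
      using yy by (simp add: t_def power2_eq_square divide_le_0_iff)
    thus ?thesis by simp
  qed (simp add: zero)
  thus thesis by (rule that)
qed

lemma cadjoint_eqI:
  assumes "\<And>x y. cinner (T x) y = cinner x (S y)"
  shows "cadjoint T = S"
  unfolding cadjoint_def
proof (rule the_equality)
  fix R assume "\<forall>x y. cinner (T x) y = cinner x (R y)"
  hence "cinner x (R y) = cinner x (S y)" for x y
    using assms[of x y] by simp
  thus "R = S" by (intro ext cinner_ext)
qed (use assms in blast)

text \<open>
  Riesz representation gives an adjoint for the real inner product. It is also the adjoint for the
  complex one, because the imaginary part of \<^const>\<open>cinner\<close> is the real inner product with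
  \<open>\<i> x\<close> and the operator commutes with \<open>\<i>\<close>.
\<close>
lemma cinner_cadjoint:
  fixes T :: "'a::complex_hilbert_space \<Rightarrow> 'b::complex_inner"
  assumes "bounded_clinear T"
  shows "cinner (T x) y = cinner x (cadjoint T y)"
proof -
  interpret bounded_linear T using assms by (rule bounded_clinearD)
  have "\<exists>z. \<forall>x. inner (T x) y = inner z x" for y
    by (rule riesz_representation[of "\<lambda>x. inner (T x) y"])
      (auto intro: bounded_linear_compose[OF bounded_linear_inner_left bounded_linear_axioms])
  then obtain S where S: "\<And>x y. inner (T x) y = inner x (S y)"
    by (metis inner_commute)
  have "cinner (T x) y = cinner x (S y)" for x y
    by (simp add: cinner_conv_inner S bounded_clinearD(2)[OF assms, symmetric])
  thus ?thesis
    using cadjoint_eqI[of T S] by metis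
qed

lemma inner_cadjoint:
  fixes T :: "'a::complex_hilbert_space \<Rightarrow> 'b::complex_inner"
  assumes "bounded_clinear T"
  shows "inner (T x) y = inner x (cadjoint T y)"
  using cinner_cadjoint[OF assms, of x y] by (simp flip: Re_cinner)

lemma cinner_cadjoint_left:
  fixes T :: "'a::complex_hilbert_space \<Rightarrow> 'b::complex_inner"
  assumes "bounded_clinear T"
  shows "cinner (cadjoint T y) x = cinner y (T x)"
  using cinner_cadjoint[OF assms, of x y]
  by (simp add: cinner_commute[of "cadjoint T y"] cinner_commute[of y])

lemma bounded_clinear_cadjoint:
  fixes T :: "'a::complex_hilbert_space \<Rightarrow> 'b::complex_inner"
  assumes "bounded_clinear T"
  shows "bounded_clinear (cadjoint T)"
proof -
  note adj = cinner_cadjoint[OF assms, symmetric]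
  have add: "cadjoint T (x + y) = cadjoint T x + cadjoint T y" for x y
    by (rule cinner_ext) (simp add: adj cinner_add_right)
  have scale: "cadjoint T (c *\<^sub>C x) = c *\<^sub>C cadjoint T x" for c x
    by (rule cinner_ext) (simp add: adj cinner_scaleC_right)
  obtain K where K: "0 \<le> K" "\<And>x. norm (T x) \<le> norm x * K"
    using bounded_linear.nonneg_bounded[OF bounded_clinearD(1)[OF assms]] by blast
  have "norm (cadjoint T y) \<le> norm y * K" for y
  proof (cases "cadjoint T y = 0")
    case True
    thus ?thesis using K(1) by simp
  next
    case False
    have "(norm (cadjoint T y))\<^sup>2 = inner (T (cadjoint T y)) y"
      by (simp add: inner_cadjoint[OF assms] power2_norm_eq_inner)
    also have "\<dots> \<le> norm (T (cadjoint T y)) * norm y"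
      by (rule norm_cauchy_schwarz)
    also have "\<dots> \<le> (norm (cadjoint T y) * K) * norm y"
      by (intro mult_right_mono K) simp
    finally show ?thesis
      using False by (simp add: power2_eq_square mult_ac)
  qed
  thus ?thesis
    unfolding bounded_clinear_def
    by (auto intro!: bounded_linear_intro[where K = K] simp: add scale simp flip: scaleC_of_real)
qed

lemma bounded_clinear_vec:
  assumes "\<And>j. bounded_clinear (T j)"
  shows "bounded_clinear (\<lambda>x. \<chi> j. T j x)"
proof -
  have 1: "bounded_linear (T j)" for j
    using assms bounded_clinearD(1) by blast
  obtain K where K: "\<And>j x. norm (T j x) \<le> norm x * K j"
    using bounded_linear.bounded[OF 1] by metis
  have "norm (\<chi> j. T j x) \<le> norm x * (\<Sum>j\<in>UNIV. K j)" for x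
  proof -
    have "norm (\<chi> j. T j x) \<le> (\<Sum>j\<in>UNIV. norm (T j x))"
      unfolding norm_vec_def by (rule order_trans[OF L2_set_le_sum]) auto
    also have "\<dots> \<le> norm x * (\<Sum>j\<in>UNIV. K j)"
      unfolding sum_distrib_left by (intro sum_mono K)
    finally show ?thesis .
  qed
  hence "bounded_linear (\<lambda>x. \<chi> j. T j x)"
    by (intro bounded_linear_intro[where K = "\<Sum>j\<in>UNIV. K j"])
      (simp_all add: vec_eq_iff bounded_linear.linear[OF 1] linear_add linear_scale)
  thus ?thesis
    using assms by (auto simp: bounded_clinear_def scaleC_vec_def vec_eq_iff)
qed

lemma bounded_clinear_component:
  "bounded_clinear T \<Longrightarrow> bounded_clinear (\<lambda>x. T x $ j)"
  unfolding bounded_clinear_def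
  using bounded_linear_compose[OF bounded_linear_vec_nth[of j], of T] by (simp add: scaleC_vec_def)

lemma bounded_clinear_col_op:
  assumes "bounded_clinear S" "bounded_clinear T"
  shows "bounded_clinear (col_op S T)"
  using assms unfolding col_op_def bounded_clinear_def scaleC_prod_def
  by (auto intro: bounded_linear_Pair)

lemma cadjoint_col_op:
  fixes S :: "'a::complex_hilbert_space \<Rightarrow> 'b::complex_inner" and T :: "'a \<Rightarrow> 'c::complex_inner"
  assumes "bounded_clinear S" "bounded_clinear T"
  shows "cadjoint (col_op S T) = row_op (cadjoint S) (cadjoint T)"
  by (rule cadjoint_eqI)
    (auto simp: col_op_def row_op_def cinner_prod_def cinner_add_right
      cinner_cadjoint[OF assms(1)] cinner_cadjoint[OF assms(2)])


section \<open>Finite orthonormal bases\<close>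

abbreviation orthonormal :: "'a::complex_inner set \<Rightarrow> bool" where
  "orthonormal E \<equiv> (\<forall>e\<in>E. cinner e e = 1) \<and> pairwise (\<lambda>e e'. cinner e e' = 0) E"

lemma orthonormal_coeff:
  assumes "orthonormal E" "finite F" "F \<subseteq> E" "e \<in> F"
  shows "cinner e (\<Sum>e\<in>F. c e *\<^sub>C e) = c e"
proof -
  have "cinner e (\<Sum>e\<in>F. c e *\<^sub>C e) = (\<Sum>e'\<in>F. c e' * cinner e e')"
    by (simp add: cinner_sum_right cinner_scaleC_right)
  also have "\<dots> = (\<Sum>e'\<in>F. if e' = e then c e else 0)"
  proof (rule sum.cong)
    fix e' assume "e' \<in> F"
    show "c e' * cinner e e' = (if e' = e then c e else 0)"
      using assms \<open>e' \<in> F\<close> by (cases "e' = e") (auto simp: pairwise_def subset_iff)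
  qed simp
  also have "\<dots> = c e"
    using assms by simp
  finally show ?thesis .
qed

lemma orthonormal_independent:
  assumes "orthonormal E"
  shows "complex_vector.independent E"
proof
  assume "complex_vector.dependent E"
  then obtain F c e where F: "finite F" "F \<subseteq> E" "(\<Sum>e\<in>F. c e *\<^sub>C e) = 0" "e \<in> F" "c e \<noteq> 0"
    unfolding complex_vector.dependent_explicit by blast
  with orthonormal_coeff[OF assms F(1,2,4), of c] show False by simp
qed

lemma orthonormal_expansion:
  assumes "orthonormal E" "finite E" "x \<in> complex_vector.span E"
  shows "x = (\<Sum>e\<in>E. cinner e x *\<^sub>C e)"
proof -
  obtain c where c: "x = (\<Sum>e\<in>E. c e *\<^sub>C e)"
    using assms(3) unfolding complex_vector.span_finite[OF assms(2)] by blast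
  have "(\<Sum>e\<in>E. cinner e x *\<^sub>C e) = (\<Sum>e\<in>E. c e *\<^sub>C e)"
    by (intro sum.cong refl) (simp add: c orthonormal_coeff[OF assms(1,2) order_refl])
  thus ?thesis using c by simp
qed

text \<open>
  The span is where the identity agrees with the orthogonal projection, a continuous map: its
  coefficients are expressed by real inner products, for which continuity is immediate.
\<close>
lemma closed_span_orthonormal:
  assumes "orthonormal E" "finite E"
  shows "closed (complex_vector.span E)"
proof -
  have coeff: "cinner e x *\<^sub>C e = inner e x *\<^sub>R e + inner (\<i> *\<^sub>C e) x *\<^sub>R (\<i> *\<^sub>C e)" for e x :: 'a
  proof -
    have "cinner e x = complex_of_real (inner e x) + complex_of_real (inner (\<i> *\<^sub>C e) x) * \<i>"
      by (simp add: cinner_conv_inner complex_eq_iff)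
    thus ?thesis
      by (simp only: scaleC_add_left scaleC_scaleC[symmetric] scaleC_of_real)
  qed
  have "complex_vector.span E = {x. x = (\<Sum>e\<in>E. cinner e x *\<^sub>C e)}"
  proof (intro equalityI subsetI CollectI)
    fix x assume "x \<in> {x. x = (\<Sum>e\<in>E. cinner e x *\<^sub>C e)}"
    hence "x = (\<Sum>e\<in>E. cinner e x *\<^sub>C e)" by (rule CollectD)
    moreover have "(\<Sum>e\<in>E. cinner e x *\<^sub>C e) \<in> complex_vector.span E"
      by (intro complex_vector.span_sum complex_vector.span_scale complex_vector.span_base)
    ultimately show "x \<in> complex_vector.span E" by (rule ssubst)
  qed (rule orthonormal_expansion[OF assms])
  also have "closed \<dots>"
    unfolding coeff by (intro closed_Collect_eq continuous_intros)
  finally show ?thesis .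
qed

text \<open>One step of the Gram--Schmidt process per vector of the spanning set.\<close>
lemma finite_orthonormal_spanning:
  assumes "finite F"
  shows "\<exists>E. finite E \<and> orthonormal E \<and> complex_vector.span E = complex_vector.span F"
  using assms
proof (induction F rule: finite_induct)
  case empty
  show ?case by (rule exI[of _ "{}"]) auto
next
  case (insert a F)
  then obtain E where E: "finite E" "orthonormal E" "complex_vector.span E = complex_vector.span F"
    by blast
  define p where "p = (\<Sum>e\<in>E. cinner e a *\<^sub>C e)"
  have p: "p \<in> complex_vector.span E"
    unfolding p_def by (intro complex_vector.span_sum complex_vector.span_scale complex_vector.span_base)
  have span: "complex_vector.span (insert a F) = complex_vector.span (insert (a - p) E)"
  proof -
    have "complex_vector.span (insert a F) = complex_vector.span (insert a E)"
      using E(3) by (simp add: complex_vector.span_insert)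
    also have "\<dots> = complex_vector.span (insert (a - p) E)"
      by (rule complex_vector.eq_span_insert_eq) (simp add: p)
    finally show ?thesis .
  qed
  show ?case
  proof (cases "a = p")
    case True
    hence "complex_vector.span (insert a F) = complex_vector.span E"
      using span by simp
    thus ?thesis using E by blast
  next
    case False
    define n where "n = norm (a - p)"
    define b where "b = complex_of_real (1 / n) *\<^sub>C (a - p)"
    have n: "n > 0" using False by (simp add: n_def)
    have orth: "cinner e b = 0" if "e \<in> E" for e
      using orthonormal_coeff[OF E(2,1) order_refl that, of "\<lambda>e. cinner e a"]
      by (simp add: b_def cinner_scaleC_right cinner_diff_right p_def)
    have "norm b = 1"
      using n unfolding b_def scaleC_of_real by (simp add: n_def)
    hence "cinner b b = 1" by (simp add: cinner_self)
    moreover have "cinner b e = 0" if "e \<in> E" for e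
      using orth[OF that] cinner_commute[of b e] by simp
    ultimately have "orthonormal (insert b E)"
      using E(2) orth by (auto simp: pairwise_insert)
    moreover have "complex_vector.span (insert b E) = complex_vector.span (insert (a - p) E)"
      unfolding complex_vector.span_eq
    proof
      have "a - p = complex_of_real n *\<^sub>C b"
        using n by (simp add: b_def scaleC_of_real)
      thus "insert (a - p) E \<subseteq> complex_vector.span (insert b E)"
        by (auto intro: complex_vector.span_scale complex_vector.span_base)
      show "insert b E \<subseteq> complex_vector.span (insert (a - p) E)"
        unfolding b_def by (auto intro: complex_vector.span_scale complex_vector.span_base)
    qed
    ultimately show ?thesis
      using E(1) span by (intro exI[of _ "insert b E"]) auto
  qed
qed

lemma orthonormal_basis_finite_dimensional:
  assumes "finite_dimensional S" "orthonormal_basis E S"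
  shows "finite E" "complex_vector.span E = S" "closed S"
proof -
  obtain F where F: "finite F" "complex_vector.span F = S"
    using assms(1) by (auto simp: finite_dimensional_def)
  have on: "orthonormal E" and cl: "closure (complex_vector.span E) = S"
    using assms(2) by (auto simp: orthonormal_basis_def)
  have "E \<subseteq> complex_vector.span F"
    using F cl closure_subset complex_vector.span_superset by blast
  thus fin: "finite E"
    using complex_vector.independent_span_bound[OF F(1) orthonormal_independent[OF on]] by blast
  thus "complex_vector.span E = S" "closed S"
    using cl closed_span_orthonormal[OF on fin] by auto
qed

text \<open>The choice in \<^const>\<open>hilbert_dim\<close> is a meaningful one as soon as some orthonormal basis exists.\<close>
lemma hilbert_dim_finite_dimensional:
  assumes "finite_dimensional S"
  obtains E where "orthonormal_basis E S" "hilbert_dim S = card_of E"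
proof -
  obtain F where F: "finite F" "complex_vector.span F = S"
    using assms by (auto simp: finite_dimensional_def)
  obtain E where E: "finite E" "orthonormal E" "complex_vector.span E = S"
    using finite_orthonormal_spanning[OF F(1)] F(2) by blast
  have "orthonormal_basis E S"
    using E closed_span_orthonormal[OF E(2,1)] by (auto simp: orthonormal_basis_def)
  hence "orthonormal_basis (SOME E. orthonormal_basis E S) S"
    by (rule someI)
  thus thesis
    by (rule that) (simp add: hilbert_dim_def)
qed


section \<open>Completing an isometry to a unitary\<close>

text \<open>
  Composing the factorisation with \<open>V\<close> and with \<open>T\<close> gives \<open>T T\<^sup>* V = 0\<close> and, from this,
  \<open>T T\<^sup>* T = T\<close>; injectivity cancels the leftmost \<open>T\<close>. Without it \<open>T\<close> could be a
  backward shift, with \<open>V\<close> the zero map on the zero space.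
\<close>
lemma isometry_completion:
  fixes V :: "'x::complex_hilbert_space \<Rightarrow> 'k::complex_inner"
    and T :: "'u::complex_hilbert_space \<Rightarrow> 'k"
  assumes "bounded_clinear V" and T: "bounded_clinear T" and "inj T"
    and isometric: "\<And>x. cadjoint V (V x) = x"
    and complement: "\<And>p. T (cadjoint T p) = p - V (cadjoint V p)"
  shows "cadjoint T (T u) = u" and "cadjoint V (T u) = 0"
proof -
  have T0: "T 0 = 0"
    using bounded_clinearD(1)[OF T] by (rule linear_simps)
  have "T (cadjoint T (V x)) = T 0" for x
    by (simp add: complement isometric T0)
  hence "cadjoint T (V x) = 0" for x
    using \<open>inj T\<close> by (blast dest: injD)
  hence "cinner x (cadjoint V (T u)) = cinner x 0" for x
    by (simp add: cinner_cadjoint[OF assms(1), symmetric] cinner_cadjoint_left[OF T, symmetric])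
  thus ran: "cadjoint V (T u) = 0"
    by (rule cinner_ext)
  have "V 0 = 0"
    using bounded_clinearD(1)[OF assms(1)] by (rule linear_simps)
  hence "T (cadjoint T (T u)) = T u"
    by (simp add: complement ran)
  thus "cadjoint T (T u) = u"
    using \<open>inj T\<close> by (blast dest: injD)
qed

text \<open>
  If \<open>Q = T T\<^sup>*\<close> is a projection, \<open>T\<^sup>*\<close> maps an orthonormal basis of its range to an orthonormal set.
  By the dimension count this set has as many elements as a basis of the domain of \<open>T\<close>, so it
  spans, and a vector in the kernel of \<open>T\<close>, being orthogonal to it, is zero.
\<close>
lemma inj_if_dim_eq_rank:
  fixes T :: "'u::complex_hilbert_space \<Rightarrow> 'k::complex_hilbert_space"
  assumes T: "bounded_clinear T"
    and TT: "\<And>p. T (cadjoint T p) = Q p" and proj: "\<And>p. Q (Q p) = Q p"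
    and fin: "finite_dimensional (UNIV :: 'u set)"
    and dim: "(hilbert_dim (UNIV :: 'u set), op_rank Q) \<in> ordIso"
  shows "inj T"
proof -
  interpret T: bounded_linear T using T by (rule bounded_clinearD)
  obtain E where E: "orthonormal_basis E (UNIV :: 'u set)" "hilbert_dim (UNIV :: 'u set) = card_of E"
    using fin by (rule hilbert_dim_finite_dimensional)
  note E_fin = orthonormal_basis_finite_dimensional[OF fin E(1)]
  have Q: "bounded_clinear Q"
    using bounded_clinear_comp[OF T bounded_clinear_cadjoint[OF T]] by (simp add: TT)
  have sub: "complex_vector.subspace (range Q)"
  proof (rule complex_vector.subspaceI)
    interpret Q: bounded_linear Q using Q by (rule bounded_clinearD)
    show "0 \<in> range Q"
      using rangeI[of Q 0] by (simp add: Q.zero)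
    show "x + y \<in> range Q" if xy: "x \<in> range Q" "y \<in> range Q" for x y
    proof -
      obtain p q where "x = Q p" "y = Q q" using xy by blast
      thus ?thesis using rangeI[of Q "p + q"] by (simp add: Q.add)
    qed
    show "c *\<^sub>C x \<in> range Q" if x: "x \<in> range Q" for c x
    proof -
      obtain p where "x = Q p" using x by blast
      thus ?thesis using rangeI[of Q "c *\<^sub>C p"] by (simp add: bounded_clinearD(2)[OF Q])
    qed
  qed
  have ran: "range Q \<subseteq> complex_vector.span (T ` E)"
  proof
    fix q assume "q \<in> range Q"
    then obtain u where q: "q = T u" by (auto simp flip: TT)
    have "u = (\<Sum>e\<in>E. cinner e u *\<^sub>C e)"
      using E(1) E_fin by (intro orthonormal_expansion) (auto simp: orthonormal_basis_def)
    hence "q = T (\<Sum>e\<in>E. cinner e u *\<^sub>C e)" using q by simp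
    also have "\<dots> = (\<Sum>e\<in>E. cinner e u *\<^sub>C T e)"
      by (simp add: T.sum bounded_clinearD(2)[OF T])
    also have "\<dots> \<in> complex_vector.span (T ` E)"
      by (intro complex_vector.span_sum complex_vector.span_scale complex_vector.span_base imageI)
    finally show "q \<in> complex_vector.span (T ` E)" .
  qed
  obtain G where G: "G \<subseteq> range Q" "complex_vector.independent G" "range Q \<subseteq> complex_vector.span G"
    by (rule complex_vector.basis_exists)
  have "finite G"
    using complex_vector.independent_span_bound[of "T ` E" G] G E_fin ran by auto
  moreover have "complex_vector.span G = range Q"
    using G sub by (simp add: complex_vector.span_minimal subset_antisym)
  ultimately have finQ: "finite_dimensional (range Q)"
    by (auto simp: finite_dimensional_def)
  obtain F where F: "orthonormal_basis F (range Q)" "hilbert_dim (range Q) = card_of F"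
    using finQ by (rule hilbert_dim_finite_dimensional)
  note F_fin = orthonormal_basis_finite_dimensional[OF finQ F(1)]
  have "(card_of E, card_of F) \<in> ordIso"
    using dim E(2) F(2) F_fin(3) by (simp add: op_rank_def)
  then obtain h where "bij_betw h E F"
    unfolding card_of_ordIso[symmetric] by blast
  hence card: "card E = card F" by (rule bij_betw_same_card)
  have T_adj: "T (cadjoint T f) = f" if "f \<in> F" for f
  proof -
    have "f \<in> range Q"
      using that F_fin(2) complex_vector.span_base by blast
    thus ?thesis using proj by (auto simp: TT)
  qed
  \<comment> \<open>A lift of the orthonormal basis of the range, with as many elements as a basis of the domain.\<close>
  define E' where "E' = cadjoint T ` F"
  have inj_adj: "inj_on (cadjoint T) F"
    by (rule inj_on_inverseI[of _ T]) (rule T_adj)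
  have "cinner (cadjoint T f) (cadjoint T g) = cinner f g" if "g \<in> F" for f g
    by (simp add: cinner_cadjoint_left[OF T] T_adj that)
  hence on: "orthonormal E'"
    using F(1) by (auto simp: E'_def orthonormal_basis_def pairwise_def)
  have card': "finite E'" "card E' = card E"
    using F_fin(1) by (simp_all add: E'_def card_image[OF inj_adj] card)
  have span: "u \<in> complex_vector.span E'" for u
  proof (rule ccontr)
    assume u: "u \<notin> complex_vector.span E'"
    hence "complex_vector.independent (insert u E')"
      using orthonormal_independent[OF on] by (rule complex_vector.independent_insertI)
    hence "card (insert u E') \<le> card E"
      using complex_vector.independent_span_bound[of E "insert u E'"] E_fin by auto
    moreover have "u \<notin> E'" using u complex_vector.span_base by blast
    ultimately show False using card' by simp
  qed
  have "u = 0" if "T u = 0" for u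
  proof -
    have "cinner e u = 0" if "e \<in> E'" for e
      using that \<open>T u = 0\<close> by (auto simp: E'_def cinner_cadjoint_left[OF T])
    moreover have "u = (\<Sum>e\<in>E'. cinner e u *\<^sub>C e)"
      by (rule orthonormal_expansion[OF on card'(1) span])
    ultimately have "u = (\<Sum>e\<in>E'. 0 *\<^sub>C e)" by simp
    thus ?thesis by simp
  qed
  thus ?thesis
    using T.linear_axioms linear_injective_0 by blast
qed


section \<open>Sums over words\<close>

lemma finite_words [simp]: "finite {v :: 'd::finite list. length v = n}"
  using finite_lists_length_eq[of "UNIV :: 'd set" n] by simp

lemma sum_words_Suc:
  fixes h :: "'d::finite list \<Rightarrow> 'b::comm_monoid_add"
  shows "(\<Sum>v\<in>{v. length v = Suc n}. h v) = (\<Sum>v\<in>{v. length v = n}. \<Sum>j\<in>UNIV. h (j # v))"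
proof -
  have "{v :: 'd list. length v = Suc n} = (\<lambda>(v, j). j # v) ` ({v. length v = n} \<times> UNIV)"
    by (auto simp: length_Suc_conv image_iff)
  moreover have "inj_on (\<lambda>(v, j). j # v) ({v :: 'd list. length v = n} \<times> UNIV)"
    by (auto simp: inj_on_def)
  ultimately show ?thesis
    by (simp add: sum.reindex sum.cartesian_product case_prod_unfold)
qed

lemma sum_words_snoc:
  fixes h :: "'d::finite list \<Rightarrow> 'b::comm_monoid_add"
  shows "(\<Sum>v\<in>{v. length v = Suc n}. h v) = (\<Sum>v\<in>{v. length v = n}. \<Sum>j\<in>UNIV. h (v @ [j]))"
proof -
  have "{v :: 'd list. length v = Suc n} = (\<lambda>(v, j). v @ [j]) ` ({v. length v = n} \<times> UNIV)"
    by (auto simp: length_Suc_conv_rev image_iff)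
  moreover have "inj_on (\<lambda>(v, j). v @ [j]) ({v :: 'd list. length v = n} \<times> UNIV)"
    by (auto simp: inj_on_def)
  ultimately show ?thesis
    by (simp add: sum.reindex sum.cartesian_product case_prod_unfold)
qed

lemma sum_words_add:
  fixes h :: "'d::finite list \<Rightarrow> 'b::comm_monoid_add"
  shows "(\<Sum>v\<in>{v. length v = m + n}. h v) = (\<Sum>w\<in>{w. length w = m}. \<Sum>v\<in>{v. length v = n}. h (v @ w))"
  by (induction n arbitrary: h) (simp_all add: sum_words_Suc)

lemma sum_words_less:
  fixes h :: "'d::finite list \<Rightarrow> 'b::comm_monoid_add"
  shows "finite {v :: 'd list. length v < N}"
    and "(\<Sum>v\<in>{v. length v < N}. h v) = (\<Sum>k<N. \<Sum>v\<in>{v. length v = k}. h v)"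
proof -
  have "finite {v :: 'd list. length v < N} \<and>
        (\<Sum>v\<in>{v. length v < N}. h v) = (\<Sum>k<N. \<Sum>v\<in>{v. length v = k}. h v)"
  proof (induction N)
    case (Suc N)
    have "{v :: 'd list. length v < Suc N} = {v. length v < N} \<union> {v. length v = N}" by auto
    thus ?case using Suc by (auto simp: sum.union_disjoint disjoint_iff)
  qed simp
  thus "finite {v :: 'd list. length v < N}"
    and "(\<Sum>v\<in>{v. length v < N}. h v) = (\<Sum>k<N. \<Sum>v\<in>{v. length v = k}. h v)" by auto
qed

lemma finite_set_of_words_bounded:
  assumes "finite (F :: 'd::finite list set)"
  obtains N where "F \<subseteq> {v. length v < N}"
proof -
  have "F \<subseteq> {v. length v < Suc (Max (length ` F))}"
    using assms by (auto simp: less_Suc_eq_le)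
  thus thesis by (rule that)
qed

text \<open>Every finite set of words is eventually contained in the set of words of length less than \<open>N\<close>.\<close>
lemma tendsto_sum_words:
  fixes h :: "'d::finite list \<Rightarrow> 'b::{comm_monoid_add,topological_space}"
  assumes "(h has_sum s) UNIV"
  shows "(\<lambda>N. \<Sum>k<N. \<Sum>v\<in>{v. length v = k}. h v) \<longlonglongrightarrow> s"
proof -
  have "filterlim (\<lambda>N. {v :: 'd list. length v < N}) (finite_subsets_at_top UNIV) sequentially"
    unfolding filterlim_finite_subsets_at_top
  proof safe
    fix F :: "'d list set" assume "finite F"
    then obtain M where "F \<subseteq> {v. length v < M}" by (rule finite_set_of_words_bounded)
    thus "\<forall>\<^sub>F N in sequentially. finite {v :: 'd list. length v < N} \<and> F \<subseteq> {v. length v < N} \<and>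
            {v :: 'd list. length v < N} \<subseteq> UNIV"
      by (intro eventually_sequentiallyI[of M]) (auto simp: sum_words_less(1))
  qed
  from filterlim_compose[OF assms[unfolded has_sum_def] this] show ?thesis
    by (simp add: sum_words_less(2))
qed

definition level_energy :: "('d::finite list \<Rightarrow> 'a::real_normed_vector) \<Rightarrow> nat \<Rightarrow> real" where
  "level_energy f n = (\<Sum>v\<in>{v. length v = n}. (norm (f v))\<^sup>2)"

lemma level_energy_nonneg: "0 \<le> level_energy f n"
  by (simp add: level_energy_def sum_nonneg)

lemma level_energy_add_le:
  fixes f g :: "'d::finite list \<Rightarrow> 'b::real_normed_vector"
  shows "level_energy (\<lambda>v. f v + g v) n \<le> 2 * level_energy f n + 2 * level_energy g n"
proof -
  have "(norm (a + b))\<^sup>2 \<le> 2 * (norm a)\<^sup>2 + 2 * (norm b)\<^sup>2" for a b :: 'b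
  proof -
    have "(norm (a + b))\<^sup>2 \<le> (norm a + norm b)\<^sup>2"
      by (intro power_mono norm_triangle_ineq) simp
    also have "\<dots> \<le> 2 * (norm a)\<^sup>2 + 2 * (norm b)\<^sup>2"
      using sum_squares_bound[of "norm a" "norm b"] by (simp add: power2_sum)
    finally show ?thesis .
  qed
  thus ?thesis
    unfolding level_energy_def sum_distrib_left sum.distrib[symmetric] by (intro sum_mono)
qed

lemma H2_bound:
  fixes f :: "'d::finite list \<Rightarrow> 'y::complex_inner"
  assumes "\<And>N. (\<Sum>k<N. level_energy f k) \<le> K"
  shows "f \<in> H2"
  unfolding H2_def
proof (intro CollectI nonneg_bdd_above_summable_on bdd_aboveI2)
  fix F :: "'d list set" assume "F \<in> {F. F \<subseteq> UNIV \<and> finite F}"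
  hence "finite F" by simp
  then obtain N where "F \<subseteq> {v. length v < N}" by (rule finite_set_of_words_bounded)
  hence "(\<Sum>v\<in>F. (norm (f v))\<^sup>2) \<le> (\<Sum>v\<in>{v. length v < N}. (norm (f v))\<^sup>2)"
    by (intro sum_mono2) (auto simp: sum_words_less(1))
  also have "\<dots> \<le> K"
    using assms[of N] by (simp add: sum_words_less(2) level_energy_def)
  finally show "(\<Sum>v\<in>F. (norm (f v))\<^sup>2) \<le> K" .
qed simp

lemma H2_norm_squared: "(H2_norm f)\<^sup>2 = (\<Sum>\<^sub>\<infinity>v. (norm (f v))\<^sup>2)"
  by (simp add: H2_norm_def infsum_nonneg)

lemma H2_norm_nonneg: "0 \<le> H2_norm f"
  by (simp add: H2_norm_def infsum_nonneg)

lemma H2_finite_sum_le: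
  assumes "f \<in> H2" "finite F"
  shows "(\<Sum>v\<in>F. (norm (f v))\<^sup>2) \<le> (H2_norm f)\<^sup>2"
  using assms unfolding H2_norm_squared H2_def by (intro finite_sum_le_infsum) auto

lemma H2_partial_le:
  assumes "f \<in> H2"
  shows "(\<Sum>k<N. level_energy f k) \<le> (H2_norm f)\<^sup>2"
  using H2_finite_sum_le[OF assms sum_words_less(1)[of N]]
  by (simp add: sum_words_less(2) level_energy_def)

lemma H2_tendsto:
  assumes "f \<in> H2"
  shows "(\<lambda>N. \<Sum>k<N. level_energy f k) \<longlonglongrightarrow> (H2_norm f)\<^sup>2"
  using assms unfolding H2_norm_squared level_energy_def H2_def
  by (intro tendsto_sum_words has_sum_infsum) simp

text \<open>
  An orthogonality-type bound, which gives unconditional convergence of series that need not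
  converge absolutely: the finite partial sums form a Cauchy net.
\<close>
lemma summable_on_if_square_bound:
  fixes b :: "'i \<Rightarrow> 'x::{real_normed_vector,complete_space}" and q :: "'i \<Rightarrow> real"
  assumes bound: "\<And>F. finite F \<Longrightarrow> (norm (sum b F))\<^sup>2 \<le> sum q F" and q: "q summable_on UNIV"
  shows "b summable_on UNIV"
proof -
  have q_nonneg: "0 \<le> q i" for i
    using order_trans[OF zero_le_power2 bound[of "{i}"]] by simp
  have "\<exists>P. eventually P (finite_subsets_at_top UNIV) \<and> (\<forall>F F'. P F \<and> P F' \<longrightarrow> dist (sum b F) (sum b F') < e)"
    if "0 < e" for e
  proof -
    have "(sum q \<longlongrightarrow> infsum q UNIV) (finite_subsets_at_top UNIV)"
      using has_sum_infsum[OF q] by (simp add: has_sum_def)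
    moreover have "infsum q UNIV - (e / 2)\<^sup>2 < infsum q UNIV"
      using that by simp
    ultimately have "\<forall>\<^sub>F F in finite_subsets_at_top UNIV. infsum q UNIV - (e / 2)\<^sup>2 < sum q F"
      by (rule order_tendstoD)
    then obtain F0 where F0: "finite F0" "infsum q UNIV - (e / 2)\<^sup>2 < sum q F0"
      by (auto simp: eventually_finite_subsets_at_top)
    have near: "dist (sum b F) (sum b F0) < e / 2" if F: "finite F" "F0 \<subseteq> F" for F
    proof -
      have "(norm (sum b F - sum b F0))\<^sup>2 = (norm (sum b (F - F0)))\<^sup>2"
        using F by (simp add: sum_diff)
      also have "\<dots> \<le> sum q (F - F0)"
        using F(1) by (intro bound) simp
      also have "\<dots> = sum q F - sum q F0"
        using F by (simp add: sum_diff)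
      also have "\<dots> < (e / 2)\<^sup>2"
        using F0(2) finite_sum_le_infsum[OF q F(1)] q_nonneg by simp
      finally show ?thesis
        using power2_less_imp_less[of "norm (sum b F - sum b F0)" "e / 2"] \<open>0 < e\<close>
        by (simp add: dist_norm)
    qed
    have "dist (sum b F) (sum b F') < e"
      if "finite F" "F0 \<subseteq> F" "finite F'" "F0 \<subseteq> F'" for F F'
      using near[OF that(1,2)] near[OF that(3,4)] by (rule dist_triangle_half_l)
    moreover have "\<forall>\<^sub>F F in finite_subsets_at_top UNIV. finite F \<and> F0 \<subseteq> F"
      using F0(1) unfolding eventually_finite_subsets_at_top by blast
    ultimately show ?thesis by blast
  qed
  hence "cauchy_filter (filtermap (sum b) (finite_subsets_at_top UNIV))"
    by (simp add: cauchy_filter_metric_filtermap)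
  then obtain s where "(sum b \<longlongrightarrow> s) (finite_subsets_at_top UNIV)"
    using complete_uniform[where S = "UNIV :: 'x set"] complete_UNIV by (force simp: filterlim_def)
  thus ?thesis
    unfolding summable_on_def has_sum_def by blast
qed

lemma word_op_append: "word_op A (v @ w) = word_op A v \<circ> word_op A w"
  by (induction v) auto

text \<open>
  The two recursions for the convolution product: the decompositions of \<open>j w\<close> are the one with
  empty left factor and those obtained by putting \<open>j\<close> in front of the left factor in a
  decomposition of \<open>w\<close>.
\<close>
lemma sum_splits_Nil: "(\<Sum>(u, v)\<in>{(u, v). u @ v = []}. h u v) = h [] []"
proof -
  have "{(u, v). u @ v = []} = {([], [])}" by auto
  thus ?thesis by simp
qed

lemma finite_splits: "finite {(u, v). u @ v = w}"
proof (rule finite_subset)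
  show "{(u, v). u @ v = w} \<subseteq> (\<lambda>n. (take n w, drop n w)) ` {..length w}"
  proof safe
    fix u v :: "'a list"
    show "(u, v) \<in> (\<lambda>n. (take n (u @ v), drop n (u @ v))) ` {..length (u @ v)}"
      by (rule image_eqI[of _ _ "length u"]) auto
  qed
qed simp

lemma sum_splits_Cons:
  "(\<Sum>(u, v)\<in>{(u, v). u @ v = j # w}. h u v) = h [] (j # w) + (\<Sum>(u, v)\<in>{(u, v). u @ v = w}. h (j # u) v)"
proof -
  let ?S = "{(u, v). u @ v = w}"
  have "{(u, v). u @ v = j # w} = insert ([], j # w) ((\<lambda>(u, v). (j # u, v)) ` ?S)"
    by (auto simp: Cons_eq_append_conv append_eq_Cons_conv image_iff)
  moreover have "inj_on (\<lambda>(u, v). (j # u, v)) ?S"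
    by (auto simp: inj_on_def)
  moreover have "([], j # w) \<notin> (\<lambda>(u, v). (j # u, v)) ` ?S" by auto
  moreover have "finite ?S" by (rule finite_splits)
  ultimately show ?thesis
    by (simp add: sum.reindex case_prod_unfold)
qed


text \<open>Only the decomposition with empty left factor contributes.\<close>
lemma sum_splits_if_Nil: "(\<Sum>(u, v)\<in>{(u, v). u @ v = w}. if u = [] then h v else 0) = h w"
  by (cases w) (simp_all add: sum_splits_Nil sum_splits_Cons)

lemma sum_splits_add:
  "(\<Sum>(u, v)\<in>{(u, v). u @ v = w}. h u v + k u v)
     = (\<Sum>(u, v)\<in>{(u, v). u @ v = w}. h u v) + (\<Sum>(u, v)\<in>{(u, v). u @ v = w}. k u v)"
  by (simp add: case_prod_unfold sum.distrib)


section \<open>Unitary colligations\<close>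

lemma norm_vec_power2:
  fixes p :: "'x::real_inner ^ 'd"
  shows "(norm p)\<^sup>2 = (\<Sum>j\<in>UNIV. (norm (p $ j))\<^sup>2)"
  by (simp add: power2_norm_eq_inner inner_vec_def)

text \<open>
  The adjoint of an analysis operator \<open>h \<mapsto> (a\<^sub>v h)\<^sub>v\<close> that is a contraction is a contraction:
  this is \<open>2 \<langle>y\<^sub>v, a\<^sub>v h\<rangle> \<le> \<parallel>y\<^sub>v\<parallel>\<^sup>2 + \<parallel>a\<^sub>v h\<parallel>\<^sup>2\<close> summed over \<open>v\<close>, for \<open>h\<close> the synthesised vector.
\<close>
lemma synthesis_bound:
  fixes b :: "'i \<Rightarrow> 'y::real_inner \<Rightarrow> 'x::real_inner"
  assumes adj: "\<And>v y h. inner (b v y) h = inner y (a v h)"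
    and contraction: "\<And>h. (\<Sum>v\<in>F. (norm (a v h))\<^sup>2) \<le> (norm h)\<^sup>2"
  shows "(norm (\<Sum>v\<in>F. b v (y v)))\<^sup>2 \<le> (\<Sum>v\<in>F. (norm (y v))\<^sup>2)"
proof -
  define h where "h = (\<Sum>v\<in>F. b v (y v))"
  have ineq: "2 * inner p q \<le> (norm p)\<^sup>2 + (norm q)\<^sup>2" for p q :: 'y
    using inner_ge_zero[of "p - q"] by (simp add: power2_norm_eq_inner inner_diff inner_commute)
  have "2 * (norm h)\<^sup>2 = 2 * inner (\<Sum>v\<in>F. b v (y v)) h"
    by (simp add: h_def power2_norm_eq_inner)
  also have "\<dots> = (\<Sum>v\<in>F. 2 * inner (y v) (a v h))"
    by (simp add: inner_sum_left adj sum_distrib_left)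
  also have "\<dots> \<le> (\<Sum>v\<in>F. (norm (y v))\<^sup>2 + (norm (a v h))\<^sup>2)"
    by (intro sum_mono ineq)
  also have "\<dots> \<le> (\<Sum>v\<in>F. (norm (y v))\<^sup>2) + (norm h)\<^sup>2"
    using contraction[of h] by (simp add: sum.distrib)
  finally show ?thesis by (simp add: h_def)
qed

text \<open>
  \<open>Z\<^sub>j\<close> and \<open>X\<close> are the adjoints of \<open>A\<^sub>j\<close> and \<open>C\<close>. Adjointness and unitarity are stated with real
  inner products: the real part of a complex inner product determines the whole form, and energies only
  involve norms. Unitarity is preservation of the inner product together with surjectivity.
\<close>
locale unitary_colligation =
  fixes A :: "'x::complex_hilbert_space \<Rightarrow> 'x ^ 'd::finite"
    and B :: "'u::complex_hilbert_space \<Rightarrow> 'x ^ 'd"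
    and C :: "'x \<Rightarrow> 'y::complex_hilbert_space"
    and D :: "'u \<Rightarrow> 'y"
    and Z :: "'d \<Rightarrow> 'x \<Rightarrow> 'x"
    and X :: "'y \<Rightarrow> 'x"
  assumes A: "bounded_clinear A" and B: "bounded_clinear B"
    and C: "bounded_clinear C" and D: "bounded_clinear D"
    and Z: "\<And>j. bounded_linear (Z j)" and X: "bounded_linear X"
    and inner_Z: "\<And>j x y. inner (Z j x) y = inner x (A y $ j)"
    and inner_X: "\<And>x y. inner (X y) x = inner y (C x)"
    and isometric: "\<And>x u x' u'. inner (A x + B u) (A x' + B u') + inner (C x + D u) (C x' + D u')
                      = inner x x' + inner u u'"
    and surjective: "\<And>p y. \<exists>x u. A x + B u = p \<and> C x + D u = y"
    and stable: "strongly_stable (\<lambda>j x. A x $ j)"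
begin

lemmas lin = bounded_clinearD(1)[OF A] bounded_clinearD(1)[OF B] bounded_clinearD(1)[OF C]
  bounded_clinearD(1)[OF D]

lemma zero: "A 0 = 0" "B 0 = 0" "C 0 = 0" "D 0 = 0"
  using lin by (simp_all add: linear_simps)

abbreviation A_word :: "'d list \<Rightarrow> 'x \<Rightarrow> 'x" where
  "A_word \<equiv> word_op (\<lambda>j x. A x $ j)"

lemma bounded_clinear_A_word: "bounded_clinear (A_word v)"
proof (induction v)
  case Nil
  show ?case by (simp add: bounded_clinear_def id_def bounded_linear_ident)
next
  case (Cons j v)
  show ?case
    using bounded_clinear_component[OF bounded_clinear_comp[OF A Cons.IH], of j]
    by (simp add: comp_def)
qed

lemma bounded_linear_Z_word: "bounded_linear (word_op Z v)"
proof (induction v)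
  case (Cons j v)
  show ?case
    using bounded_linear_compose[OF Z Cons.IH, of j] by (simp add: comp_def)
qed (simp add: id_def bounded_linear_ident)

text \<open>Taking adjoints reverses the order of the factors; this is where the transposed word comes from.\<close>
lemma inner_Z_word: "inner (word_op Z (rev v) x) h = inner x (A_word v h)"
  by (induction v arbitrary: x) (simp_all add: word_op_append inner_Z)

text \<open>
  A solution of the system equations \<open>x(jv) = A\<^sub>j x(v) + B\<^sub>j f(v)\<close>, \<open>y(v) = C x(v) + D f(v)\<close>, with
  state \<open>x\<close>, input \<open>f\<close> and output \<open>y\<close> indexed by words.
\<close>
definition trajectory :: "('d list \<Rightarrow> 'x) \<Rightarrow> ('d list \<Rightarrow> 'u) \<Rightarrow> ('d list \<Rightarrow> 'y) \<Rightarrow> bool" where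
  "trajectory x f y \<longleftrightarrow>
     (\<forall>v. A (x v) + B (f v) = (\<chi> j. x (j # v)) \<and> C (x v) + D (f v) = y v)"

text \<open>
  Each step preserves energy because the colligation matrix is isometric; summed over all words of
  length less than \<open>N\<close>, everything except the states of length \<open>N\<close> is accounted for.
\<close>
lemma trajectory_energy:
  assumes "trajectory x f y"
  shows "(\<Sum>k<N. level_energy y k) + level_energy x N
       = (norm (x []))\<^sup>2 + (\<Sum>k<N. level_energy f k)"
proof (induction N)
  case 0
  show ?case by (simp add: level_energy_def)
next
  case (Suc N)
  have step: "(\<Sum>j\<in>UNIV. (norm (x (j # v)))\<^sup>2) + (norm (y v))\<^sup>2 = (norm (x v))\<^sup>2 + (norm (f v))\<^sup>2" for v
  proof -
    have eqs: "A (x v) + B (f v) = (\<chi> j. x (j # v))" "C (x v) + D (f v) = y v"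
      using assms by (simp_all add: trajectory_def)
    show ?thesis
      using isometric[of "x v" "f v" "x v" "f v"]
      unfolding eqs by (simp add: norm_vec_power2 flip: power2_norm_eq_inner)
  qed
  have "level_energy x (Suc N) + level_energy y N = level_energy x N + level_energy f N"
    unfolding level_energy_def sum_words_Suc sum.distrib[symmetric] by (simp only: step)
  thus ?case using Suc.IH by simp
qed

text \<open>
  Without input, the outputs are the coefficients of the observability operator, the adjoint of the
  controllability operator. The energy balance bounds it by one.
\<close>
lemma free_trajectory: "trajectory (\<lambda>v. A_word v h) (\<lambda>v. 0) (\<lambda>v. C (A_word v h))"
  by (simp add: trajectory_def zero vec_eq_iff)

lemma free_energy: "(\<Sum>k<N. level_energy (\<lambda>v. C (A_word v h)) k) + level_energy (\<lambda>v. A_word v h) N = (norm h)\<^sup>2"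
  using trajectory_energy[OF free_trajectory, of h N] by (simp add: level_energy_def)

lemma controllability_partial_bound:
  assumes "finite F"
  shows "(norm (\<Sum>v\<in>F. word_op Z (rev v) (X (g v))))\<^sup>2 \<le> (\<Sum>v\<in>F. (norm (g v))\<^sup>2)"
proof (rule synthesis_bound)
  show "inner (word_op Z (rev v) (X y)) h = inner y (C (A_word v h))" for v y h
    by (simp add: inner_Z_word inner_X)
  show "(\<Sum>v\<in>F. (norm (C (A_word v h)))\<^sup>2) \<le> (norm h)\<^sup>2" for h
  proof -
    obtain N where "F \<subseteq> {v. length v < N}" using assms by (rule finite_set_of_words_bounded)
    hence "(\<Sum>v\<in>F. (norm (C (A_word v h)))\<^sup>2) \<le> (\<Sum>v\<in>{v. length v < N}. (norm (C (A_word v h)))\<^sup>2)"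
      by (intro sum_mono2) (auto simp: sum_words_less(1))
    also have "\<dots> \<le> (norm h)\<^sup>2"
      using free_energy[of h N] level_energy_nonneg[of "\<lambda>v. A_word v h" N]
      by (simp add: sum_words_less(2) level_energy_def)
    finally show ?thesis .
  qed
qed

lemma state_synthesis_bound:
  "(norm (\<Sum>v\<in>{v. length v = N}. word_op Z (rev v) (x v)))\<^sup>2 \<le> level_energy x N"
  unfolding level_energy_def
proof (rule synthesis_bound)
  show "inner (word_op Z (rev v) y) h = inner y (A_word v h)" for v y h
    by (rule inner_Z_word)
  show "(\<Sum>v\<in>{v. length v = N}. (norm (A_word v h))\<^sup>2) \<le> (norm h)\<^sup>2" for h
  proof -
    have "0 \<le> (\<Sum>k<N. level_energy (\<lambda>v. C (A_word v h)) k)"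
      by (intro sum_nonneg level_energy_nonneg)
    hence "level_energy (\<lambda>v. A_word v h) N \<le> (norm h)\<^sup>2"
      using free_energy[of h N] by linarith
    thus ?thesis by (simp add: level_energy_def)
  qed
qed

text \<open>The first component of \<open>U\<^sup>* U = I\<close>.\<close>
lemma state_recovery:
  assumes "A x + B u = p" "C x + D u = y"
  shows "(\<Sum>j\<in>UNIV. Z j (p $ j)) + X y = x"
proof -
  have "inner ((\<Sum>j\<in>UNIV. Z j (p $ j)) + X y) h = inner x h" for h
    using isometric[of x u h 0] assms
    by (simp add: zero inner_add_left inner_sum_left inner_Z inner_X inner_vec_def)
  thus ?thesis using vector_eq_rdot by blast
qed

text \<open>Substituting the state recovery formula repeatedly, starting from the empty word.\<close>
lemma trajectory_telescope:
  assumes "trajectory x f y"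
  shows "(\<Sum>k<N. \<Sum>v\<in>{v. length v = k}. word_op Z (rev v) (X (y v)))
       + (\<Sum>v\<in>{v. length v = N}. word_op Z (rev v) (x v)) = x []"
proof (induction N)
  case (Suc N)
  have step: "(\<Sum>j\<in>UNIV. word_op Z (rev (j # v)) (x (j # v))) + word_op Z (rev v) (X (y v))
            = word_op Z (rev v) (x v)" for v
  proof -
    interpret W: bounded_linear "word_op Z (rev v)" by (rule bounded_linear_Z_word)
    have "(\<Sum>j\<in>UNIV. Z j (x (j # v))) + X (y v) = x v"
      using assms state_recovery[of "x v" "f v" "\<chi> j. x (j # v)" "y v"] by (simp add: trajectory_def)
    hence "word_op Z (rev v) (x v) = word_op Z (rev v) ((\<Sum>j\<in>UNIV. Z j (x (j # v))) + X (y v))"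
      by simp
    thus ?thesis by (simp add: W.add W.sum word_op_append)
  qed
  let ?R = "\<lambda>N. \<Sum>v\<in>{v. length v = N}. word_op Z (rev v) (x v)"
  let ?P = "\<lambda>N. \<Sum>v\<in>{v. length v = N}. word_op Z (rev v) (X (y v))"
  have "(\<Sum>k<Suc N. ?P k) + ?R (Suc N) = (\<Sum>k<N. ?P k) + (?R (Suc N) + ?P N)"
    by (simp add: ac_simps)
  also have "?R (Suc N) + ?P N = ?R N"
    unfolding sum_words_Suc sum.distrib[symmetric] by (simp only: step)
  finally show ?case using Suc.IH by simp
qed simp


subsection \<open>The trajectory with zero initial state\<close>

fun state :: "('d list \<Rightarrow> 'u) \<Rightarrow> 'd list \<Rightarrow> 'x" where
  "state f [] = 0"
| "state f (j # v) = (A (state f v) + B (f v)) $ j"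

abbreviation \<theta> :: "'d list \<Rightarrow> 'u \<Rightarrow> 'y" where
  "\<theta> \<equiv> transfer_function A B C D"

lemma state_unique:
  assumes "trajectory x f y" "x [] = 0"
  shows "x = state f"
proof
  have step: "x (j # v) = (A (x v) + B (f v)) $ j" for j v
    using assms(1) by (simp add: trajectory_def)
  fix v show "x v = state f v"
    by (induction v) (simp_all only: assms(2) state.simps step)
qed

text \<open>
  The part of an input entering at \<open>v\<close> reaches \<open>u v\<close> after passing through \<open>B\<close> with the
  last letter of \<open>u\<close> and through \<open>A\<close> with the letters before it. For empty \<open>u\<close> it has not entered the
  state yet.
\<close>
lemma state_closed_form:
  "state f w = (\<Sum>(u, v)\<in>{(u, v). u @ v = w}.
     if u = [] then 0 else A_word (butlast u) (B (f v) $ last u))"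
proof (induction w)
  case Nil
  show ?case by (simp add: sum_splits_Nil)
next
  case (Cons j w)
  interpret Aj: bounded_linear "\<lambda>x. A x $ j"
    using bounded_clinear_component[OF A] by (rule bounded_clinearD)
  have head: "(if (j # u :: 'd list) = [] then 0 else A_word (butlast (j # u)) (B (f v) $ last (j # u)))
      = (if u = [] then B (f v) $ j else 0)
      + A (if u = [] then 0 else A_word (butlast u) (B (f v) $ last u)) $ j" for u v
    by (simp add: zero)
  show ?case
    unfolding sum_splits_Cons head
    by (simp add: Cons.IH sum_splits_add sum_splits_if_Nil) (simp add: Aj.sum add.commute case_prod_unfold)
qed

lemma transfer_function_output: "series_mult \<theta> f w = C (state f w) + D (f w)"
proof -
  interpret C: bounded_linear C using C by (rule bounded_clinearD)
  have split: "\<theta> u (f v) = (if u = [] then D (f v) else 0)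
      + C (if u = [] then 0 else A_word (butlast u) (B (f v) $ last u))" for u v
    by (simp add: transfer_function_def zero)
  show ?thesis
    unfolding series_mult_def split sum_splits_add sum_splits_if_Nil state_closed_form
    by (simp add: case_prod_unfold C.sum add.commute)
qed

lemma state_trajectory: "trajectory (state f) f (series_mult \<theta> f)"
  by (simp add: trajectory_def transfer_function_output vec_eq_iff)

lemma output_unique:
  assumes "trajectory x f y" "x [] = 0"
  shows "y = series_mult \<theta> f"
proof
  fix v
  have "y v = C (x v) + D (f v)"
    using assms(1) by (simp add: trajectory_def)
  thus "y v = series_mult \<theta> f v"
    by (simp only: state_unique[OF assms] transfer_function_output)
qed

lemma state_add: "state (\<lambda>v. f v + g v) w = state f w + state g w"
  using lin by (induction w) (simp_all add: linear_simps)

lemma bounded_clinear_\<theta>: "bounded_clinear (\<theta> v)"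
  using D bounded_clinear_comp[OF C bounded_clinear_comp[OF bounded_clinear_A_word[of "butlast v"]
    bounded_clinear_component[OF B, of "last v"]]]
  by (simp add: transfer_function_def)


subsection \<open>The transfer function is inner\<close>

text \<open>After the input has stopped the state evolves freely, so it is driven to zero by stability.\<close>
lemma level_energy_state_finite_input:
  assumes "\<And>v. length v \<ge> M \<Longrightarrow> f v = 0"
  shows "(\<lambda>N. level_energy (state f) N) \<longlonglongrightarrow> 0"
proof -
  have free: "state f (v @ w) = A_word v (state f w)" if "length w = M" for v w
    using that by (induction v) (simp_all add: assms zero)
  have "level_energy (state f) (M + k)
      = (\<Sum>w\<in>{w. length w = M}. \<Sum>v\<in>{v. length v = k}. (norm (A_word v (state f w)))\<^sup>2)" for k
    unfolding level_energy_def sum_words_add by (intro sum.cong) (auto simp: free)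
  moreover have "(\<lambda>k. \<Sum>w\<in>{w. length w = M}. \<Sum>v\<in>{v. length v = k}. (norm (A_word v (state f w)))\<^sup>2)
      \<longlonglongrightarrow> (\<Sum>w\<in>{w :: 'd list. length w = M}. 0)"
    by (rule tendsto_sum) (use stable in \<open>simp add: strongly_stable_def\<close>)
  ultimately have "(\<lambda>k. level_energy (state f) (k + M)) \<longlonglongrightarrow> 0"
    by (simp add: add.commute)
  thus ?thesis by (rule LIMSEQ_offset)
qed

text \<open>
  Cut the input after a long time: the first part drives the state to zero in the limit, and by the
  energy balance the state generated by the remainder has at most the energy of that remainder.
\<close>
lemma level_energy_state:
  assumes "f \<in> H2"
  shows "(\<lambda>N. level_energy (state f) N) \<longlonglongrightarrow> 0"
proof (rule LIMSEQ_I)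
  fix e :: real assume "0 < e"
  let ?E = "(H2_norm f)\<^sup>2"
  have "\<forall>\<^sub>F M in sequentially. ?E - e / 4 < (\<Sum>k<M. level_energy f k)"
    using H2_tendsto[OF assms] \<open>0 < e\<close> by (intro order_tendstoD) auto
  then obtain M where M: "?E - e / 4 < (\<Sum>k<M. level_energy f k)"
    by (auto simp: eventually_sequentially)
  define f1 where "f1 v = (if length v < M then f v else 0)" for v
  define f2 where "f2 v = (if length v < M then 0 else f v)" for v
  have f: "f = (\<lambda>v. f1 v + f2 v)" by (auto simp: f1_def f2_def)
  have level_f2: "level_energy f2 k = (if k < M then 0 else level_energy f k)" for k
    by (auto simp: level_energy_def f2_def)
  have tail: "level_energy (state f2) N < e / 4" for N
  proof -
    have "level_energy (state f2) N \<le> (\<Sum>k<N. level_energy f2 k)"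
      using trajectory_energy[OF state_trajectory, of f2 N]
        sum_nonneg[of "{..<N}" "level_energy (series_mult \<theta> f2)"]
      by (simp add: level_energy_nonneg)
    \<comment> \<open>Enlarging the range past \<open>M\<close> spares a distinction of cases between \<open>N < M\<close> and \<open>N \<ge> M\<close>.\<close>
    also have "\<dots> \<le> (\<Sum>k<M + N. level_energy f2 k)"
      by (intro sum_mono2) (auto simp: level_energy_nonneg)
    also have "\<dots> = (\<Sum>k<M + N. level_energy f k) - (\<Sum>k<M. level_energy f k)"
      by (induction N) (simp_all add: level_f2)
    also have "\<dots> < e / 4"
      using M H2_partial_le[OF assms, of "M + N"] by simp
    finally show ?thesis .
  qed
  have "(\<lambda>N. level_energy (state f1) N) \<longlonglongrightarrow> 0"
    by (rule level_energy_state_finite_input[of M]) (simp add: f1_def)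
  hence "\<forall>\<^sub>F N in sequentially. level_energy (state f1) N < e / 4"
    using \<open>0 < e\<close> by (intro order_tendstoD) auto
  then obtain N0 where N0: "\<And>N. N \<ge> N0 \<Longrightarrow> level_energy (state f1) N < e / 4"
    by (auto simp: eventually_sequentially)
  show "\<exists>N0. \<forall>N\<ge>N0. norm (level_energy (state f) N - 0) < e"
  proof (intro exI allI impI)
    fix N assume "N0 \<le> N"
    have "state f = (\<lambda>v. state f1 v + state f2 v)"
      by (subst f) (simp add: fun_eq_iff state_add)
    hence "level_energy (state f) N \<le> 2 * level_energy (state f1) N + 2 * level_energy (state f2) N"
      using level_energy_add_le[of "state f1" "state f2" N] by simp
    also have "\<dots> < e" using N0[OF \<open>N0 \<le> N\<close>] tail[of N] by simp
    finally show "norm (level_energy (state f) N - 0) < e"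
      by (simp add: level_energy_nonneg)
  qed
qed

text \<open>The energy balance with initial state zero, in the limit where no energy is stored any more.\<close>
lemma series_mult_isometric:
  assumes "f \<in> H2"
  shows "series_mult \<theta> f \<in> H2" and "H2_norm (series_mult \<theta> f) = H2_norm f"
proof -
  have bal: "(\<Sum>k<N. level_energy (series_mult \<theta> f) k) = (\<Sum>k<N. level_energy f k) - level_energy (state f) N" for N
    using trajectory_energy[OF state_trajectory, of f N] by simp
  show H2: "series_mult \<theta> f \<in> H2"
  proof (rule H2_bound)
    show "(\<Sum>k<N. level_energy (series_mult \<theta> f) k) \<le> (H2_norm f)\<^sup>2" for N
      using bal[of N] H2_partial_le[OF assms, of N] level_energy_nonneg[of "state f" N] by simp
  qed
  have "(\<lambda>N. \<Sum>k<N. level_energy (series_mult \<theta> f) k) \<longlonglongrightarrow> (H2_norm f)\<^sup>2 - 0"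
    unfolding bal by (intro tendsto_diff H2_tendsto level_energy_state assms)
  with H2_tendsto[OF H2] have "(H2_norm (series_mult \<theta> f))\<^sup>2 = (H2_norm f)\<^sup>2"
    using LIMSEQ_unique by fastforce
  thus "H2_norm (series_mult \<theta> f) = H2_norm f"
    by (rule power2_eq_imp_eq) (rule H2_norm_nonneg)+
qed

theorem inner_multiplier_\<theta>: "inner_multiplier \<theta>"
  by (simp add: inner_multiplier_def schur_class_def bounded_clinear_\<theta> series_mult_isometric)


subsection \<open>The range of the transfer function\<close>

lemma controllability_summable:
  assumes "g \<in> H2"
  shows "(\<lambda>v. word_op Z (rev v) (X (g v))) summable_on UNIV"
proof (rule summable_on_if_square_bound)
  show "(\<lambda>v. (norm (g v))\<^sup>2) summable_on UNIV"
    using assms by (simp add: H2_def)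
qed (rule controllability_partial_bound)

lemma controllability_tendsto:
  assumes "g \<in> H2"
  shows "(\<lambda>N. \<Sum>k<N. \<Sum>v\<in>{v. length v = k}. word_op Z (rev v) (X (g v))) \<longlonglongrightarrow> controllability_op Z X g"
  unfolding controllability_op_def
  by (intro tendsto_sum_words has_sum_infsum controllability_summable assms)

text \<open>
  By telescoping, the partial controllability sums of an output with initial state zero are remainders
  \<open>- R(N)\<close> built from the states at words of length \<open>N\<close>, whose energy tends to zero.
\<close>
lemma range_subset_kernel:
  assumes "f \<in> H2"
  shows "controllability_op Z X (series_mult \<theta> f) = 0"
proof -
  let ?R = "\<lambda>N. \<Sum>v\<in>{v. length v = N}. word_op Z (rev v) (state f v)"
  have "(\<lambda>N. (norm (?R N))\<^sup>2) \<longlonglongrightarrow> 0"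
    by (rule tendsto_sandwich[OF _ _ tendsto_const level_energy_state[OF assms]])
      (auto simp: state_synthesis_bound)
  hence "?R \<longlonglongrightarrow> 0"
    by (simp add: tendsto_norm_zero_iff)
  hence "(\<lambda>N. - ?R N) \<longlonglongrightarrow> - 0"
    by (rule tendsto_minus)
  moreover have "(\<Sum>k<N. \<Sum>v\<in>{v. length v = k}. word_op Z (rev v) (X (series_mult \<theta> f v))) = - ?R N" for N
    using trajectory_telescope[OF state_trajectory, of f N] by (simp add: eq_neg_iff_add_eq_0)
  ultimately show ?thesis
    using controllability_tendsto[OF series_mult_isometric(1)[OF assms]] LIMSEQ_unique by fastforce
qed

text \<open>
  The state of the system that has \<open>g\<close> as output is the controllability operator applied to the
  part of \<open>g\<close> still to come, that is to \<open>w \<mapsto> g(wv)\<close>. Since the colligation matrix is onto, an input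
  producing the pair \<open>(x(jv))\<^sub>j, g(v)\<close> exists, and by state recovery it starts from the state \<open>x(v)\<close>.
\<close>
lemma kernel_subset_range:
  assumes g: "g \<in> H2" and ker: "controllability_op Z X g = 0"
  obtains f where "f \<in> H2" "g = series_mult \<theta> f"
proof -
  \<comment> \<open>Finite approximations of the states, for which the recursion in \<open>v\<close> is a rearrangement of finite sums.\<close>
  define P where "P n v = (\<Sum>k<n. \<Sum>w\<in>{w. length w = k}. word_op Z (rev w) (X (g (w @ v))))" for n v
  define x where "x v = controllability_op Z X (\<lambda>w. g (w @ v))" for v
  have shift: "(\<lambda>w. g (w @ v)) \<in> H2" for v
  proof (rule H2_bound)
    fix N
    have "(\<Sum>k<N. level_energy (\<lambda>w. g (w @ v)) k) = (\<Sum>w\<in>{w. length w < N}. (norm (g (w @ v)))\<^sup>2)"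
      by (simp add: sum_words_less(2) level_energy_def)
    also have "\<dots> = (\<Sum>u\<in>(\<lambda>w. w @ v) ` {w. length w < N}. (norm (g u))\<^sup>2)"
      by (simp add: sum.reindex inj_on_def)
    also have "\<dots> \<le> (H2_norm g)\<^sup>2"
      by (intro H2_finite_sum_le g finite_imageI sum_words_less(1))
    finally show "(\<Sum>k<N. level_energy (\<lambda>w. g (w @ v)) k) \<le> (H2_norm g)\<^sup>2" .
  qed
  have lim: "(\<lambda>n. P n v) \<longlonglongrightarrow> x v" for v
    unfolding P_def x_def by (rule controllability_tendsto[OF shift])
  have P_rec: "P (Suc n) v = (\<Sum>j\<in>UNIV. Z j (P n (j # v))) + X (g v)" for n v
  proof -
    have "P (Suc n) v = (\<Sum>k<n. \<Sum>w\<in>{w. length w = k}. \<Sum>j\<in>UNIV. Z j (word_op Z (rev w) (X (g (w @ j # v))))) + X (g v)"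
      unfolding P_def sum.lessThan_Suc_shift sum_words_snoc by (simp add: add.commute)
    also have "(\<Sum>k<n. \<Sum>w\<in>{w. length w = k}. \<Sum>j\<in>UNIV. Z j (word_op Z (rev w) (X (g (w @ j # v)))))
        = (\<Sum>j\<in>UNIV. \<Sum>k<n. \<Sum>w\<in>{w. length w = k}. Z j (word_op Z (rev w) (X (g (w @ j # v)))))"
      by (simp add: sum.swap[where B = UNIV])
    also have "\<dots> = (\<Sum>j\<in>UNIV. Z j (P n (j # v)))"
      unfolding P_def by (simp add: linear_sum[OF bounded_linear.linear[OF Z]])
    finally show ?thesis .
  qed
  have x_rec: "x v = (\<Sum>j\<in>UNIV. Z j (x (j # v))) + X (g v)" for v
  proof (rule LIMSEQ_unique)
    show "(\<lambda>n. P (Suc n) v) \<longlonglongrightarrow> x v"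
      using lim by (rule LIMSEQ_Suc)
    show "(\<lambda>n. P (Suc n) v) \<longlonglongrightarrow> (\<Sum>j\<in>UNIV. Z j (x (j # v))) + X (g v)"
      unfolding P_rec by (intro tendsto_intros bounded_linear.tendsto[OF Z] lim)
  qed
  have "\<exists>u. A (x v) + B u = (\<chi> j. x (j # v)) \<and> C (x v) + D u = g v" for v
  proof -
    obtain x' u where u: "A x' + B u = (\<chi> j. x (j # v))" "C x' + D u = g v"
      using surjective by blast
    have "x' = x v"
      using state_recovery[OF u] x_rec[of v] by simp
    thus ?thesis using u by blast
  qed
  then obtain f where "\<And>v. A (x v) + B (f v) = (\<chi> j. x (j # v)) \<and> C (x v) + D (f v) = g v"
    by metis
  hence tr: "trajectory x f g"
    by (simp add: trajectory_def)
  have x0: "x [] = 0"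
    using ker by (simp add: x_def)
  \<comment> \<open>Each word of length at least \<open>N\<close> has exactly one suffix \<open>v\<close> of length \<open>N\<close>, so no coefficient of \<open>g\<close> is counted twice.\<close>
  have x_bound: "level_energy x N \<le> (H2_norm g)\<^sup>2" for N
  proof (rule LIMSEQ_le_const2)
    show "(\<lambda>n. level_energy (P n) N) \<longlonglongrightarrow> level_energy x N"
      unfolding level_energy_def by (intro tendsto_intros lim)
    have "level_energy (P n) N \<le> (H2_norm g)\<^sup>2" for n
    proof -
      have "level_energy (P n) N \<le> (\<Sum>v\<in>{v. length v = N}. \<Sum>w\<in>{w. length w < n}. (norm (g (w @ v)))\<^sup>2)"
        unfolding level_energy_def P_def sum_words_less(2)[symmetric]
        by (intro sum_mono controllability_partial_bound sum_words_less(1))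
      also have "\<dots> = (\<Sum>(v, w)\<in>{v. length v = N} \<times> {w. length w < n}. (norm (g (w @ v)))\<^sup>2)"
        by (rule sum.cartesian_product)
      also have "\<dots> = (\<Sum>u\<in>(\<lambda>(v, w). w @ v) ` ({v. length v = N} \<times> {w. length w < n}). (norm (g u))\<^sup>2)"
        by (subst sum.reindex) (auto simp: inj_on_def case_prod_unfold)
      also have "\<dots> \<le> (H2_norm g)\<^sup>2"
        by (intro H2_finite_sum_le g finite_imageI finite_cartesian_product sum_words_less(1) finite_words)
      finally show ?thesis .
    qed
    thus "\<exists>M. \<forall>n\<ge>M. level_energy (P n) N \<le> (H2_norm g)\<^sup>2" by blast
  qed
  have "f \<in> H2"
  proof (rule H2_bound)
    show "(\<Sum>k<N. level_energy f k) \<le> 2 * (H2_norm g)\<^sup>2" for N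
      using trajectory_energy[OF tr, of N] x0 x_bound[of N] H2_partial_le[OF g, of N] by simp
  qed
  moreover have "g = series_mult \<theta> f"
    by (rule output_unique[OF tr x0])
  ultimately show thesis by (rule that)
qed

theorem interpolation_subspace_eq_range: "interpolation_subspace Z X = series_mult \<theta> ` H2"
proof
  show "interpolation_subspace Z X \<subseteq> series_mult \<theta> ` H2"
  proof
    fix g assume "g \<in> interpolation_subspace Z X"
    hence "g \<in> H2" "controllability_op Z X g = 0"
      by (simp_all add: interpolation_subspace_def)
    then obtain f where "f \<in> H2" "g = series_mult \<theta> f"
      by (rule kernel_subset_range)
    thus "g \<in> series_mult \<theta> ` H2" by simp
  qed
  show "series_mult \<theta> ` H2 \<subseteq> interpolation_subspace Z X"
    by (auto simp: interpolation_subspace_def series_mult_isometric(1) range_subset_kernel)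
qed

end


section \<open>Interpolation data\<close>

theorem theorem5p2:
  fixes Z :: "'d::finite \<Rightarrow> 'x::complex_hilbert_space \<Rightarrow> 'x"
    and X :: "'y::complex_hilbert_space \<Rightarrow> 'x"
    and A :: "'x \<Rightarrow> 'x ^ 'd"
    and C :: "'x \<Rightarrow> 'y"
    and B :: "'u::complex_hilbert_space \<Rightarrow> 'x ^ 'd"
    and D :: "'u \<Rightarrow> 'y"
    and \<theta> :: "'d list \<Rightarrow> 'u \<Rightarrow> 'y"
  assumes "admissible_data Z X"
    and "C = cadjoint X"
    and "A = (\<lambda>x. \<chi> j. cadjoint (Z j) x)"
    and "(hilbert_dim (UNIV :: 'u set),
          op_rank (\<lambda>p. p - col_op A C (row_op (cadjoint A) (cadjoint C) p))) \<in> ordIso"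
    and "bounded_clinear B" and "bounded_clinear D"
    and "\<And>p. col_op B D (row_op (cadjoint B) (cadjoint D) p) =
              p - col_op A C (row_op (cadjoint A) (cadjoint C) p)"
    and "\<not> finite_dimensional (UNIV :: 'u set) \<Longrightarrow> inj (col_op B D)"
    and "\<theta> = transfer_function A B C D"
  shows "inner_multiplier \<theta> \<and> interpolation_subspace Z X = series_mult \<theta> ` H2"
proof -
  have Z: "bounded_clinear (Z j)" and X: "bounded_clinear X"
    and pair: "x - (\<Sum>j\<in>UNIV. Z j (cadjoint (Z j) x)) = X (cadjoint X x)"
    and stable: "strongly_stable (\<lambda>j. cadjoint (Z j))" for j x
    using assms(1) by (auto simp: admissible_data_def isometric_input_pair_def)
  have A: "bounded_clinear A" and C: "bounded_clinear C"
    unfolding assms(2,3) by (intro bounded_clinear_vec bounded_clinear_cadjoint Z X)+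
  define V where "V = col_op A C"
  define T where "T = col_op B D"
  have V: "bounded_clinear V" and T: "bounded_clinear T"
    unfolding V_def T_def by (intro bounded_clinear_col_op A C assms(5,6))+
  have V_adj: "cadjoint V = row_op (cadjoint A) (cadjoint C)"
    and T_adj: "cadjoint T = row_op (cadjoint B) (cadjoint D)"
    unfolding V_def T_def by (rule cadjoint_col_op A C assms(5,6))+
  have VV: "cadjoint V (V x) = x" for x
  proof (rule cinner_ext)
    fix h
    have "cinner h (cadjoint V (V x)) = cinner (V h) (V x)"
      by (simp add: cinner_cadjoint[OF V])
    also have "\<dots> = cinner h ((\<Sum>j\<in>UNIV. Z j (cadjoint (Z j) x)) + X (cadjoint X x))"
      by (simp add: V_def col_op_def cinner_prod_def cinner_vec_def assms(2,3) cinner_add_right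
          cinner_sum_right cinner_cadjoint_left[OF Z] cinner_cadjoint_left[OF X])
    also have "\<dots> = cinner h x"
      by (simp flip: pair)
    finally show "cinner h (cadjoint V (V x)) = cinner h x" .
  qed
  have TT: "T (cadjoint T p) = p - V (cadjoint V p)" for p
    unfolding V_adj T_adj unfolding V_def T_def by (rule assms(7))
  have "inj T"
  proof (cases "finite_dimensional (UNIV :: 'u set)")
    case True
    show ?thesis
    proof (rule inj_if_dim_eq_rank[OF T TT _ True])
      interpret V': bounded_linear "cadjoint V"
        using bounded_clinear_cadjoint[OF V] by (rule bounded_clinearD)
      interpret V: bounded_linear V using V by (rule bounded_clinearD)
      show "(p - V (cadjoint V p)) - V (cadjoint V (p - V (cadjoint V p))) = p - V (cadjoint V p)" for p
        by (simp add: V'.diff VV V.zero)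
      show "(hilbert_dim (UNIV :: 'u set), op_rank (\<lambda>p. p - V (cadjoint V p))) \<in> ordIso"
        unfolding V_adj unfolding V_def by (rule assms(4))
    qed
  next
    case False
    thus ?thesis unfolding T_def by (rule assms(8))
  qed
  note TT' = isometry_completion[OF V T this VV TT]
  \<comment> \<open>\<open>V\<close> and \<open>T\<close> are isometries with orthogonal ranges that together fill the space.\<close>
  interpret unitary_colligation A B C D Z X
  proof (rule unitary_colligation.intro)
    show "inner (Z j x) y = inner x (A y $ j)" for j x y
      by (simp add: assms(3) inner_cadjoint[OF Z])
    show "inner (X y) x = inner y (C x)" for x y
      by (simp add: assms(2) inner_cadjoint[OF X])
    show "inner (A x + B u) (A x' + B u') + inner (C x + D u) (C x' + D u') = inner x x' + inner u u'"
      for x u x' u'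
    proof -
      have cross: "inner (V x) (T u) = 0" for x u
        by (simp add: inner_cadjoint[OF V] TT')
      have "inner (A x + B u) (A x' + B u') + inner (C x + D u) (C x' + D u')
          = inner (V x + T u) (V x' + T u')"
        by (simp add: V_def T_def col_op_def inner_prod_def)
      also have "\<dots> = inner x x' + inner u u'"
        by (simp add: inner_add_left inner_add_right cross inner_commute[of "T u" "V x'"])
          (simp add: inner_cadjoint[OF V] inner_cadjoint[OF T] VV TT')
      finally show ?thesis .
    qed
    show "\<exists>x u. A x + B u = p \<and> C x + D u = y" for p y
    proof (intro exI)
      have "V (cadjoint V (p, y)) + T (cadjoint T (p, y)) = (p, y)"
        by (simp add: TT)
      thus "A (cadjoint V (p, y)) + B (cadjoint T (p, y)) = p \<and>
            C (cadjoint V (p, y)) + D (cadjoint T (p, y)) = y"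
        by (simp add: V_def T_def col_op_def)
    qed
    show "strongly_stable (\<lambda>j x. A x $ j)"
      using stable by (simp add: assms(3))
  qed (rule A C assms(5,6) bounded_clinearD(1)[OF Z] bounded_clinearD(1)[OF X])+
  show ?thesis
    unfolding assms(9) by (intro conjI inner_multiplier_\<theta> interpolation_subspace_eq_range)
qed

end
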